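(* For every partition $\lambda$, $$K_{\lambda,0}^{C_\infty}(t)=\sum_{b\in D(\lambda)}t^{|\boldsymbol{\varphi}(b)+\mu_b|/2}.$$
   Context: $\mathcal P$ is the set of all partitions. Write $\omega_i=(1^i)$, so each partition is $\kappa=\sum_i a_i\omega_i$ with $a_i$ the number of columns of height $i$; $|\kappa|=\sum_i i a_i$. Let $\mathcal P^{(2)}=\{\sum_i 2a_i\omega_i\}$ (all rows of even length), $\mathcal P^{(1,1)}=\{\sum_i a_i\omega_{2i}\}$ (all columns of even height), $\mathcal P^{\boxplus}=\mathcal P^{(2)}\cap\mathcal P^{(1,1)}$, with $a_i\in\mathbb Z_{\ge0}$ almost all zero. For partitions, $\lambda\le_{\boxplus}\mu$ means $\mu-\lambda\in\mathcal P^{\boxplus}$. $B(\lambda)$ is the type $A_{+\infty}$ crystal of semistandard tableaux of shape $\lambda$ with entries in $\{1<2<3<\cdots\}$. For $b\in B(\lambda)$ and $i\ge1$: read $b$ by columns from right to left, each from top to bottom; keep only letters $i$ (written $+$) and $i+1$ (written $-$); recursively delete adjacent factors $+-$; the result is $-^{p}+^{q}$, and $\varepsilon_i(b)=p$, $\varphi_i(b)=q$. Set $\boldsymbol{\varepsilon}(b)=\sum_i\varepsilon_i(b)\omega_i$ and $\boldsymbol{\varphi}(b)=\sum_i\varphi_i(b)\omega_i$ (finite sums). For a partition $\mu$, $b\in B(\lambda)$ is $\mu$-distinguished if there is $(\nu,\delta)\in\mathcal P^{(2)}\times\mathcal P^{(1,1)}$ with $\boldsymbol{\varphi}(b)=\nu-\mu$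 and $\boldsymbol{\varepsilon}(b)=\delta-\mu$. $D(\lambda)$ is the set of $b\in B(\lambda)$ that are $\mu$-distinguished for at least one partition $\mu$. For $b\in D(\lambda)$, $\mu_b$ is the (unique) $\le_{\boxplus}$-minimal partition $\mu$ such that $b$ is $\mu$-distinguished; explicitly $\mu_b=\sum_i(\varphi_{2i}(b)\bmod 2)\,\omega_{2i}$ with residues in $\{0,1\}$. $K_{\lambda,0}^{C_\infty}(t)$ is the stabilized generalized exponent of type $C$: the formal power series determined by $$\frac{K_{\lambda,0}^{C_\infty}(t)}{\prod_{i\ge1}(1-t^{2i})}=\sum_{\nu\in\mathcal P^{(2)}}\sum_{\delta\in\mathcal P^{(1,1)}}t^{|\nu|/2}c_{\lambda,\delta}^{\nu},$$ where $c_{\lambda,\delta}^{\nu}$ are Littlewood–Richardson coefficients. It is the limit as $n\to\infty$ of the zero-weight Lusztig $t$-analogues $K^{\mathfrak{sp}_{2n}}_{\lambda,0}(t)$. *)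

theory Defs
  imports
    "HOL-Analysis.Analysis"
    "HOL-Library.Poly_Mapping"
begin

section \<open>Partitions\<close>

text \<open>A partition is the function sending \<open>j\<close> to the length of its row \<open>j\<close>, with rows counted
  from \<open>0\<close>. Columns of a diagram are counted from \<open>0\<close> as well; the letters of tableaux start at \<open>1\<close>.\<close>

definition partitions :: "(nat \<Rightarrow> nat) set" where
  "partitions = {\<kappa>. antimono \<kappa> \<and> finite {j. \<kappa> j \<noteq> 0}}"

definition psize :: "(nat \<Rightarrow> nat) \<Rightarrow> nat" where
  "psize \<kappa> = (\<Sum>j | \<kappa> j \<noteq> 0. \<kappa> j)"

definition omega :: "nat \<Rightarrow> nat \<Rightarrow> nat" where
  "omega i = (\<lambda>j. if j < i then 1 else 0)"

text \<open>The combination \<open>\<Sum>\<^sub>i\<^sub>\<ge>\<^sub>1 a\<^sub>i v\<^sub>i\<close> for a finitely supported family of coefficients \<open>a\<close>.\<close>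

definition comb :: "(nat \<Rightarrow> nat) \<Rightarrow> (nat \<Rightarrow> nat \<Rightarrow> nat) \<Rightarrow> nat \<Rightarrow> nat" where
  "comb a v = (\<lambda>j. \<Sum>i | 1 \<le> i \<and> a i \<noteq> 0. a i * v i j)"

definition P_two :: "(nat \<Rightarrow> nat) set" where
  "P_two = {comb (\<lambda>i. 2 * a i) omega | a. finite {i. a i \<noteq> 0}}"

definition P_oneone :: "(nat \<Rightarrow> nat) set" where
  "P_oneone = {comb a (\<lambda>i. omega (2 * i)) | a. finite {i. a i \<noteq> 0}}"

definition P_box :: "(nat \<Rightarrow> nat) set" where
  "P_box = P_two \<inter> P_oneone"

definition le_box :: "(nat \<Rightarrow> nat) \<Rightarrow> (nat \<Rightarrow> nat) \<Rightarrow> bool" where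
  "le_box lam \<mu> \<longleftrightarrow> (\<exists>\<kappa>\<in>P_box. \<forall>j. int (\<kappa> j) = int (\<mu> j) - int (lam j))"

section \<open>Semistandard tableaux and the crystal\<close>

definition cells :: "(nat \<Rightarrow> nat) \<Rightarrow> (nat \<times> nat) set" where
  "cells lam = {(r, c). c < lam r}"

text \<open>\<open>T r c\<close> is the entry in row \<open>r\<close> and column \<open>c\<close>; it is set to \<open>0\<close> outside the diagram, so that
  equal tableaux are equal functions.\<close>

definition SSYT :: "(nat \<Rightarrow> nat) \<Rightarrow> (nat \<Rightarrow> nat \<Rightarrow> nat) set" where
  "SSYT lam = {T.
     (\<forall>(r, c)\<in>cells lam. 1 \<le> T r c) \<and>
     (\<forall>r c c'. c < c' \<and> (r, c') \<in> cells lam \<longrightarrow> T r c \<le> T r c') \<and>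
     (\<forall>r r' c. r < r' \<and> (r', c) \<in> cells lam \<longrightarrow> T r c < T r' c) \<and>
     (\<forall>r c. (r, c) \<notin> cells lam \<longrightarrow> T r c = 0)}"

definition col_height :: "(nat \<Rightarrow> nat) \<Rightarrow> nat \<Rightarrow> nat" where
  "col_height lam c = card {r. (r, c) \<in> cells lam}"

definition reading :: "(nat \<Rightarrow> nat) \<Rightarrow> (nat \<Rightarrow> nat \<Rightarrow> nat) \<Rightarrow> nat list" where
  "reading lam T = concat (map (\<lambda>c. map (\<lambda>r. T r c) [0..<col_height lam c]) (rev [0..<lam 0]))"

datatype sgn_letter = Plus | Minus

definition signature :: "nat \<Rightarrow> nat list \<Rightarrow> sgn_letter list" where
  "signature i w = map (\<lambda>x. if x = i then Plus else Minus) (filter (\<lambda>x. x = i \<or> x = i + 1) w)"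

inductive cancel :: "sgn_letter list \<Rightarrow> sgn_letter list \<Rightarrow> bool" where
  "cancel (u @ [Plus, Minus] @ v) (u @ v)"

definition eps :: "nat \<Rightarrow> (nat \<Rightarrow> nat) \<Rightarrow> (nat \<Rightarrow> nat \<Rightarrow> nat) \<Rightarrow> nat" where
  "eps i lam b = (THE p. \<exists>q. cancel\<^sup>*\<^sup>* (signature i (reading lam b)) (replicate p Minus @ replicate q Plus))"

definition phi :: "nat \<Rightarrow> (nat \<Rightarrow> nat) \<Rightarrow> (nat \<Rightarrow> nat \<Rightarrow> nat) \<Rightarrow> nat" where
  "phi i lam b = (THE q. \<exists>p. cancel\<^sup>*\<^sup>* (signature i (reading lam b)) (replicate p Minus @ replicate q Plus))"

definition eps_vec :: "(nat \<Rightarrow> nat) \<Rightarrow> (nat \<Rightarrow> nat \<Rightarrow> nat) \<Rightarrow> nat \<Rightarrow> nat" where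
  "eps_vec lam b = comb (\<lambda>i. eps i lam b) omega"

definition phi_vec :: "(nat \<Rightarrow> nat) \<Rightarrow> (nat \<Rightarrow> nat \<Rightarrow> nat) \<Rightarrow> nat \<Rightarrow> nat" where
  "phi_vec lam b = comb (\<lambda>i. phi i lam b) omega"

definition distinguished :: "(nat \<Rightarrow> nat) \<Rightarrow> (nat \<Rightarrow> nat) \<Rightarrow> (nat \<Rightarrow> nat \<Rightarrow> nat) \<Rightarrow> bool" where
  "distinguished lam \<mu> b \<longleftrightarrow> (\<exists>\<nu>\<in>P_two. \<exists>\<delta>\<in>P_oneone.
     (\<forall>j. int (phi_vec lam b j) = int (\<nu> j) - int (\<mu> j)) \<and>
     (\<forall>j. int (eps_vec lam b j) = int (\<delta> j) - int (\<mu> j)))"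

definition D :: "(nat \<Rightarrow> nat) \<Rightarrow> (nat \<Rightarrow> nat \<Rightarrow> nat) set" where
  "D lam = {b \<in> SSYT lam. \<exists>\<mu>\<in>partitions. distinguished lam \<mu> b}"

definition mu_min :: "(nat \<Rightarrow> nat) \<Rightarrow> (nat \<Rightarrow> nat \<Rightarrow> nat) \<Rightarrow> nat \<Rightarrow> nat" where
  "mu_min lam b = (THE \<mu>. \<mu> \<in> partitions \<and> distinguished lam \<mu> b \<and>
     (\<forall>\<mu>'\<in>partitions. distinguished lam \<mu>' b \<and> le_box \<mu>' \<mu> \<longrightarrow> \<mu>' = \<mu>))"

section \<open>Littlewood--Richardson coefficients\<close>

text \<open>Polynomials with integer coefficients in the variables \<open>x\<^sub>1, x\<^sub>2, \<dots>\<close> are finitely supported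
  maps from exponent vectors to integers; \<open>schur n lam\<close> is the Schur polynomial
  in \<open>x\<^sub>1, \<dots>, x\<^sub>n\<close>.\<close>

definition monomial_of :: "(nat \<Rightarrow> nat) \<Rightarrow> (nat \<Rightarrow> nat \<Rightarrow> nat) \<Rightarrow> (nat \<Rightarrow>\<^sub>0 nat) \<Rightarrow>\<^sub>0 int" where
  "monomial_of lam T = Poly_Mapping.single (\<Sum>(r, c)\<in>cells lam. Poly_Mapping.single (T r c) 1) 1"

definition schur :: "nat \<Rightarrow> (nat \<Rightarrow> nat) \<Rightarrow> (nat \<Rightarrow>\<^sub>0 nat) \<Rightarrow>\<^sub>0 int" where
  "schur n lam = (\<Sum>T\<in>{T \<in> SSYT lam. \<forall>(r, c)\<in>cells lam. T r c \<le> n}. monomial_of lam T)"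

text \<open>The coefficients \<open>c\<close> of \<open>s\<^sub>\<lambda> s\<^sub>\<delta> = \<Sum>\<^sub>\<nu> c\<^sub>\<nu> s\<^sub>\<nu>\<close>. The identity of Schur functions is
  imposed in every finite number of variables; no single number of variables would
  determine all of \<open>c\<close>, since \<open>s\<^sub>\<nu>\<close> vanishes once \<open>\<nu>\<close> has more than \<open>n\<close> rows.\<close>

definition LR :: "(nat \<Rightarrow> nat) \<Rightarrow> (nat \<Rightarrow> nat) \<Rightarrow> (nat \<Rightarrow> nat) \<Rightarrow> int" where
  "LR lam \<delta> = (THE c. finite {\<nu>. c \<nu> \<noteq> 0} \<and> {\<nu>. c \<nu> \<noteq> 0} \<subseteq> partitions \<and>
     (\<forall>n. schur n lam * schur n \<delta> = (\<Sum>\<nu> | c \<nu> \<noteq> 0. of_int (c \<nu>) * schur n \<nu>)))"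

section \<open>Stabilized generalized exponents of type C\<close>

text \<open>Infinite sums and products of power series refer to the \<open>t\<close>-adic topology, which is the one
  the library puts on \<^typ>\<open>rat fps\<close>.\<close>

definition even_prod :: "rat fps" where
  "even_prod = prodinf (\<lambda>i. 1 - fps_X ^ (2 * (i + 1)))"

definition LR_series :: "(nat \<Rightarrow> nat) \<Rightarrow> rat fps" where
  "LR_series lam = (\<Sum>\<^sub>\<infinity>(\<nu>, \<delta>)\<in>P_two \<times> P_oneone. of_int (LR lam \<delta> \<nu>) * fps_X ^ (psize \<nu> div 2))"

definition K_C_inf :: "(nat \<Rightarrow> nat) \<Rightarrow> rat fps" where
  "K_C_inf lam = (THE K. K / even_prod = LR_series lam)"

lemma even_prod_has_prod: "(\<lambda>i. 1 - fps_X ^ (2 * (i + 1)) :: rat fps) has_prod even_prod"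
  and even_prod_nth_0: "fps_nth even_prod 0 = 1"
proof -
  let ?f = "\<lambda>i. 1 - fps_X ^ (2 * (i + 1)) :: rat fps"
  define P where "P = Abs_fps (\<lambda>m. fps_nth (\<Prod>i\<le>m. ?f i) m)"
  have stable: "fps_nth (\<Prod>i\<le>m + k. ?f i) m = fps_nth (\<Prod>i\<le>m. ?f i) m" for m k
  proof (induction k)
    case (Suc k)
    define N where "N = 2 * (Suc (m + k) + 1)"
    have N: "m < N"
      by (simp add: N_def)
    have "(\<Prod>i\<le>m + Suc k. ?f i) = (\<Prod>i\<le>m + k. ?f i) * (1 - fps_X ^ N)"
      unfolding N_def add_Suc_right prod.atMost_Suc by (rule refl)
    also have "\<dots> = (\<Prod>i\<le>m + k. ?f i) - (\<Prod>i\<le>m + k. ?f i) * fps_X ^ N"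
      by (simp only: right_diff_distrib mult_1_right)
    also have "fps_nth \<dots> m = fps_nth (\<Prod>i\<le>m + k. ?f i) m"
      by (simp only: fps_sub_nth fps_X_power_mult_right_nth N if_True diff_zero)
    finally show ?case
      using Suc by simp
  qed simp
  have lim: "(\<lambda>n. \<Prod>i\<le>n. ?f i) \<longlonglongrightarrow> P"
  proof (rule tendsto_fpsI)
    fix m
    show "\<forall>\<^sub>F n in sequentially. fps_nth (\<Prod>i\<le>n. ?f i) m = fps_nth P m"
    proof (rule eventually_sequentiallyI[of m])
      fix n assume "m \<le> n"
      then obtain k where "n = m + k"
        using le_Suc_ex by blast
      then show "fps_nth (\<Prod>i\<le>n. ?f i) m = fps_nth P m"
        unfolding P_def fps_nth_Abs_fps by (simp only: stable)
    qed
  qed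
  have P0: "fps_nth P 0 = 1"
    by (simp add: P_def)
  then have "P \<noteq> 0"
    by auto
  with lim have "?f has_prod P"
    by (simp add: has_prod_def raw_has_prod_def)
  moreover from this have "even_prod = P"
    unfolding even_prod_def by (rule has_prod_unique[symmetric])
  ultimately show "?f has_prod even_prod" and "fps_nth even_prod 0 = 1"
    using P0 by simp_all
qed

lemma K_C_inf_iff: "K = K_C_inf lam \<longleftrightarrow> K / even_prod = LR_series lam"
proof -
  have unit: "is_unit even_prod"
    using even_prod_nth_0 by (simp add: fps_is_unit_iff)
  have iff: "K / even_prod = LR_series lam \<longleftrightarrow> K = LR_series lam * even_prod" for K
    by (rule unit_eq_div1[OF unit])
  show ?thesis
    unfolding K_C_inf_def iff by simp
qed

lemma cancel_unique:
  "\<exists>p q. cancel\<^sup>*\<^sup>* w (replicate p Minus @ replicate q Plus) \<and>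
     (\<forall>p' q'. cancel\<^sup>*\<^sup>* w (replicate p' Minus @ replicate q' Plus) \<longrightarrow> p' = p \<and> q' = q)"
proof -
  define step :: "nat \<times> nat \<Rightarrow> sgn_letter \<Rightarrow> nat \<times> nat" where
    "step = (\<lambda>(p, q) x. case x of Plus \<Rightarrow> (p, q + 1)
       | Minus \<Rightarrow> if q > 0 then (p, q - 1) else (p + 1, q))"
  define st where "st = foldl step (0, 0)"
  have inv: "st u = st v" if "cancel\<^sup>*\<^sup>* u v" for u v
    using that
  proof (induction rule: rtranclp_induct)
    case (step y z)
    have "st y = st z"
      using step(2) by cases (auto simp: st_def step_def split: prod.splits)
    with step show ?case by simp
  qed simp
  have minus: "foldl step (a, 0) (replicate p Minus) = (a + p, 0)" for a p
    by (induction p arbitrary: a) (auto simp: step_def)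
  have plus: "foldl step (a, b) (replicate q Plus) = (a, b + q)" for a b q
    by (induction q arbitrary: b) (auto simp: step_def)
  have nf: "st (replicate p Minus @ replicate q Plus) = (p, q)" for p q
    by (simp add: st_def minus plus)
  have app: "cancel\<^sup>*\<^sup>* (u @ [x]) (v @ [x])" if "cancel\<^sup>*\<^sup>* u v" for u v x
    using that
  proof (induction rule: rtranclp_induct)
    case (step y z)
    from step(2) have "cancel (y @ [x]) (z @ [x])"
    proof cases
      case (1 a b)
      then show ?thesis using cancel.intros[of a "b @ [x]"] by simp
    qed
    with step show ?case by (meson rtranclp.rtrancl_into_rtrancl)
  qed simp
  have ex: "\<exists>p q. cancel\<^sup>*\<^sup>* w (replicate p Minus @ replicate q Plus)"
  proof (induction w rule: rev_induct)
    case Nil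
    show ?case by (intro exI[of _ 0]) simp
  next
    case (snoc x w)
    then obtain p q where pq: "cancel\<^sup>*\<^sup>* w (replicate p Minus @ replicate q Plus)"
      by blast
    show ?case
    proof (cases x)
      case Plus
      then show ?thesis
        using app[OF pq, of x]
        by (intro exI[of _ p] exI[of _ "Suc q"]) (simp add: replicate_append_same)
    next
      case Minus
      show ?thesis
      proof (cases q)
        case 0
        then show ?thesis
          using app[OF pq, of x] Minus
          by (intro exI[of _ "Suc p"] exI[of _ 0]) (simp add: replicate_append_same)
      next
        case (Suc q')
        have "replicate q Plus @ [x] = replicate q' Plus @ [Plus, Minus]"
          using Minus Suc replicate_append_same[of q' Plus] by simp
        then have "cancel (replicate p Minus @ replicate q Plus @ [x]) (replicate p Minus @ replicate q' Plus)"
          using cancel.intros[of "replicate p Minus @ replicate q' Plus" "[]"] by simp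
        with app[OF pq, of x]
        have "cancel\<^sup>*\<^sup>* (w @ [x]) (replicate p Minus @ replicate q' Plus)"
          by simp
        then show ?thesis by blast
      qed
    qed
  qed
  then obtain p q where "cancel\<^sup>*\<^sup>* w (replicate p Minus @ replicate q Plus)"
    by blast
  then have "p' = p \<and> q' = q" if "cancel\<^sup>*\<^sup>* w (replicate p' Minus @ replicate q' Plus)" for p' q'
    using inv[OF that] inv[of w] nf by simp
  then show ?thesis
    using \<open>cancel\<^sup>*\<^sup>* w (replicate p Minus @ replicate q Plus)\<close> by blast
qed

end

theory Submission
  imports Defs
begin

text \<open>By the Littlewood--Richardson rule, \<open>c\<^sub>\<lambda>\<^sub>\<delta>\<^sup>\<nu>\<close> counts the tableaux \<open>T\<close> of shape \<open>\<lambda>\<close> with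
  \<open>\<delta> + wt T = \<nu>\<close> and \<open>\<epsilon>\<^sub>i(T) \<le> \<delta>\<^sub>i - \<delta>\<^sub>i\<^sub>+\<^sub>1\<close> for all \<open>i\<close>. As \<open>wt T = \<phi>(T) - \<epsilon>(T)\<close>, such
  a \<open>T\<close> amounts to a partition \<open>\<mu> = \<nu> - \<phi>(T) = \<delta> - \<epsilon>(T)\<close>, so the sum over \<open>(\<nu>, \<delta>)\<close> of the
  Littlewood--Richardson coefficients runs over the pairs \<open>(T, \<mu>)\<close> with \<open>T\<close> being \<open>\<mu>\<close>-distinguished.
  For fixed \<open>T\<close> these \<open>\<mu>\<close> form the coset \<open>\<mu>\<^sub>T + P_box\<close>, and the generating function of \<open>P_box\<close> is
  the inverse of the product on the left-hand side. The rule itself is Stembridge's: multiply an alternant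
  by a Schur polynomial and cancel the violating tableaux by Bender--Knuth involutions.\<close>

subsection \<open>Partitions and tableaux\<close>

text \<open>\<open>LR\<close> is specified by identities of Schur polynomials in every number n of
  variables, so an expansion has to be exhibited and shown to be unique. Alternants serve both ends:
  dividing by the alternant of the staircase gives the product rule, and the coefficient at a
  strictly decreasing exponent isolates a single partition. The price is attention to n:
  \<open>schur n \<nu>\<close> vanishes as soon as \<nu> has more than n rows. The involution moves
  only columns to the left of the violation because the reading goes from right to left: the columns
  that exhibit the violation stay in place, so the image fails at the same place and the pairing is
  an involution. In coordinates over the fundamental weights, \<open>P_two\<close> asks for even
  coefficients and \<open>P_oneone\<close> for zero coefficients at odd indices, so being
  distinguished splits into one condition for each i. \<open>P_box\<close> is freely generated by
  twice the weights of even index 2i, partitions of size 4i; the series records half of the size,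
  hence the factors with exponent 2i.\<close>

lemma partitions_antimono: "lam \<in> partitions \<Longrightarrow> i \<le> j \<Longrightarrow> lam j \<le> lam i"
  by (auto simp: partitions_def antimono_def)

lemma partitions_eventually_0:
  assumes "lam \<in> partitions"
  obtains R where "\<And>r. R \<le> r \<Longrightarrow> lam r = 0"
proof -
  have "finite {j. lam j \<noteq> 0}"
    using assms by (simp add: partitions_def)
  then obtain R where R: "{j. lam j \<noteq> 0} \<subseteq> {..<R}"
    unfolding finite_nat_iff_bounded by blast
  show ?thesis
  proof (rule that)
    fix r assume "R \<le> r"
    then have "r \<notin> {..<R}" by simp
    then show "lam r = 0"
      using R by blast
  qed
qed

lemma partitionsI:
  assumes "\<And>j. f (Suc j) \<le> f j" and "\<And>j. R \<le> j \<Longrightarrow> f j = 0"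
  shows "f \<in> partitions"
proof -
  have "{j. f j \<noteq> 0} \<subseteq> {..<R}"
  proof
    fix j assume "j \<in> {j. f j \<noteq> 0}"
    then show "j \<in> {..<R}"
      using assms(2)[of j] by (cases "j < R") auto
  qed
  then have "finite {j. f j \<noteq> 0}"
    by (rule finite_subset) simp
  then show ?thesis
    using assms(1) unfolding partitions_def antimono_iff_le_Suc by simp
qed

lemma finite_cells:
  assumes "lam \<in> partitions"
  shows "finite (cells lam)"
proof -
  obtain R where R: "\<And>r. R \<le> r \<Longrightarrow> lam r = 0"
    using partitions_eventually_0[OF assms] by blast
  have "cells lam \<subseteq> {..<R} \<times> {..<lam 0}"
  proof
    fix x assume "x \<in> cells lam"
    then obtain r c where x: "x = (r, c)" "c < lam r"
      by (auto simp: cells_def)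
    have "r < R"
      using R[of r] x by (cases "r < R") auto
    moreover have "c < lam 0"
      using x partitions_antimono[OF assms, of 0 r] by simp
    ultimately show "x \<in> {..<R} \<times> {..<lam 0}"
      using x by simp
  qed
  then show ?thesis
    by (rule finite_subset) simp
qed

lemma SSYT_pos: "T \<in> SSYT lam \<Longrightarrow> c < lam r \<Longrightarrow> 1 \<le> T r c"
  by (auto simp: SSYT_def cells_def)

lemma SSYT_out: "T \<in> SSYT lam \<Longrightarrow> lam r \<le> c \<Longrightarrow> T r c = 0"
  by (auto simp: SSYT_def cells_def)

lemma SSYT_row: "T \<in> SSYT lam \<Longrightarrow> c \<le> c' \<Longrightarrow> c' < lam r \<Longrightarrow> T r c \<le> T r c'"
  by (cases "c = c'") (auto simp: SSYT_def cells_def)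

lemma SSYT_col: "T \<in> SSYT lam \<Longrightarrow> r < r' \<Longrightarrow> c < lam r' \<Longrightarrow> T r c < T r' c"
  by (auto simp: SSYT_def cells_def)

lemma SSYTI:
  assumes lam: "lam \<in> partitions"
    and pos: "\<And>r c. c < lam r \<Longrightarrow> 1 \<le> T r c"
    and row: "\<And>r c. Suc c < lam r \<Longrightarrow> T r c \<le> T r (Suc c)"
    and col: "\<And>r c. c < lam (Suc r) \<Longrightarrow> T r c < T (Suc r) c"
    and out: "\<And>r c. lam r \<le> c \<Longrightarrow> T r c = 0"
  shows "T \<in> SSYT lam"
proof -
  have rows: "c' < lam r \<longrightarrow> T r c \<le> T r c'" if "c < c'" for r c c'
    using that
  proof (induction rule: strict_inc_induct)
    case (base i)
    then show ?case using row by simp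
  next
    case (step i)
    then show ?case using row[of i r] by fastforce
  qed
  have cols: "c < lam r' \<longrightarrow> T r c < T r' c" if "r < r'" for r r' c
    using that
  proof (induction rule: strict_inc_induct)
    case (base i)
    then show ?case using col by simp
  next
    case (step i)
    then show ?case
      using col[of c i] partitions_antimono[OF lam, of "Suc i" r'] by fastforce
  qed
  show ?thesis
    using pos out rows cols unfolding SSYT_def cells_def by auto
qed

lemma SSYT_entry_gt_row:
  assumes "T \<in> SSYT lam" "lam \<in> partitions" "c < lam r"
  shows "r < T r c"
  using assms(3)
proof (induction r)
  case 0
  then show ?case using SSYT_pos[OF assms(1)] by fastforce
next
  case (Suc r)
  then have "c < lam r"
    using partitions_antimono[OF assms(2), of r "Suc r"] by simp
  then show ?case
    using Suc SSYT_col[OF assms(1), of r "Suc r" c] by fastforce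
qed

text \<open>The reading word runs through the columns from right to left, so the columns from j on
  form a prefix of it. Their letter counts are what a lattice condition sees; the complementary
  \<open>head_count\<close> is what an involution on the first j columns may change.\<close>

definition tail_count :: "(nat \<Rightarrow> nat) \<Rightarrow> (nat \<Rightarrow> nat \<Rightarrow> nat) \<Rightarrow> nat \<Rightarrow> nat \<Rightarrow> nat" where
  "tail_count lam T j i = card {x \<in> cells lam. j \<le> snd x \<and> T (fst x) (snd x) = i}"

definition head_count :: "(nat \<Rightarrow> nat) \<Rightarrow> (nat \<Rightarrow> nat \<Rightarrow> nat) \<Rightarrow> nat \<Rightarrow> nat \<Rightarrow> nat" where
  "head_count lam T j i = card {x \<in> cells lam. snd x < j \<and> T (fst x) (snd x) = i}"

definition letter_count :: "(nat \<Rightarrow> nat) \<Rightarrow> (nat \<Rightarrow> nat \<Rightarrow> nat) \<Rightarrow> nat \<Rightarrow> nat" where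
  "letter_count lam T i = card {x \<in> cells lam. T (fst x) (snd x) = i}"

lemma letter_count_split:
  assumes "lam \<in> partitions"
  shows "letter_count lam T i = tail_count lam T j i + head_count lam T j i"
proof -
  have fin: "finite (cells lam)"
    using finite_cells[OF assms] .
  have "{x \<in> cells lam. T (fst x) (snd x) = i} =
     {x \<in> cells lam. j \<le> snd x \<and> T (fst x) (snd x) = i} \<union> {x \<in> cells lam. snd x < j \<and> T (fst x) (snd x) = i}"
    by auto
  then show ?thesis
    unfolding letter_count_def tail_count_def head_count_def
    by (simp only:) (intro card_Un_disjoint, use fin in auto)
qed

lemma letter_count_eq_tail_count: "letter_count lam T i = tail_count lam T 0 i"
  by (simp add: letter_count_def tail_count_def)

lemma tail_count_beyond:
  assumes "lam \<in> partitions" "lam 0 \<le> j"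
  shows "tail_count lam T j i = 0"
proof -
  have "{x \<in> cells lam. j \<le> snd x \<and> T (fst x) (snd x) = i} = {}"
  proof -
    have "\<not> j \<le> c" if "c < lam r" for r c
      using that assms(2) partitions_antimono[OF assms(1), of 0 r] by simp
    then show ?thesis
      by (auto simp: cells_def)
  qed
  then show ?thesis
    unfolding tail_count_def by (simp only: card.empty)
qed

text \<open>Columns are strictly increasing, so a column contains a letter at most once. These unit
  steps make the last violation of the lattice condition a violation by exactly one.\<close>

lemma tail_count_Suc:
  assumes T: "T \<in> SSYT lam" and lam: "lam \<in> partitions"
  shows "tail_count lam T j i = tail_count lam T (Suc j) i + (if \<exists>r. j < lam r \<and> T r j = i then 1 else 0)"
proof -
  let ?A = "{x \<in> cells lam. Suc j \<le> snd x \<and> T (fst x) (snd x) = i}"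
  let ?B = "{x \<in> cells lam. snd x = j \<and> T (fst x) (snd x) = i}"
  have eq: "{x \<in> cells lam. j \<le> snd x \<and> T (fst x) (snd x) = i} = ?A \<union> ?B"
    by auto
  have "card (?A \<union> ?B) = card ?A + card ?B"
    by (rule card_Un_disjoint) (use finite_cells[OF lam] in auto)
  moreover have "card ?B = (if \<exists>r. j < lam r \<and> T r j = i then 1 else 0)"
  proof (cases "\<exists>r. j < lam r \<and> T r j = i")
    case True
    then obtain r where r: "j < lam r" "T r j = i"
      by blast
    have uniq: "r' = r" if "j < lam r'" "T r' j = i" for r'
    proof (rule ccontr)
      assume "r' \<noteq> r"
      then consider "r < r'" | "r' < r"
        by linarith
      then show False
        using that r SSYT_col[OF T, of r r' j] SSYT_col[OF T, of r' r j] by cases simp_all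
    qed
    have "x \<in> ?B \<longleftrightarrow> x = (r, j)" for x
      using r uniq[of "fst x"] by (cases x) (auto simp: cells_def)
    then have "?B = {(r, j)}"
      by blast
    then show ?thesis
      using True by simp
  next
    case False
    then have "?B = {}"
      by (auto simp: cells_def)
    then show ?thesis
      using False by (simp only: card.empty if_False)
  qed
  ultimately show ?thesis
    unfolding tail_count_def eq by (simp only:)
qed

subsection \<open>Bender--Knuth involutions on the leading columns\<close>

text \<open>The tableau is viewed as the family of its Gelfand--Tsetlin rows \<open>row_upto lam T j i\<close>; the
  involution is the piecewise linear toggle of the rows belonging to \<open>k\<close>, restricted to the columns
  before \<open>j\<close>.\<close>

definition row_upto :: "(nat \<Rightarrow> nat) \<Rightarrow> (nat \<Rightarrow> nat \<Rightarrow> nat) \<Rightarrow> nat \<Rightarrow> nat \<Rightarrow> nat \<Rightarrow> nat" where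
  "row_upto lam T j i r = card {c. c < lam r \<and> c < j \<and> T r c \<le> i}"

text \<open>With the Gelfand-Tsetlin rows of k - 1 and k + 1 fixed, interlacing confines entry r of
  row k to the interval from \<open>tog_lo\<close> to \<open>tog_hi\<close>; \<open>toggle\<close>
  reflects it in this interval. In row 0 there is no row above to bound it.\<close>

definition tog_lo :: "(nat \<Rightarrow> nat) \<Rightarrow> (nat \<Rightarrow> nat \<Rightarrow> nat) \<Rightarrow> nat \<Rightarrow> nat \<Rightarrow> nat \<Rightarrow> nat" where
  "tog_lo lam T j k r = max (row_upto lam T j (k - 1) r) (row_upto lam T j (k + 1) (Suc r))"

definition tog_hi :: "(nat \<Rightarrow> nat) \<Rightarrow> (nat \<Rightarrow> nat \<Rightarrow> nat) \<Rightarrow> nat \<Rightarrow> nat \<Rightarrow> nat \<Rightarrow> nat" where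
  "tog_hi lam T j k r = (case r of 0 \<Rightarrow> row_upto lam T j (k + 1) 0
     | Suc r' \<Rightarrow> min (row_upto lam T j (k + 1) r) (row_upto lam T j (k - 1) r'))"

definition toggle :: "(nat \<Rightarrow> nat) \<Rightarrow> (nat \<Rightarrow> nat \<Rightarrow> nat) \<Rightarrow> nat \<Rightarrow> nat \<Rightarrow> nat \<Rightarrow> nat" where
  "toggle lam T j k r = tog_lo lam T j k r + tog_hi lam T j k r - row_upto lam T j k r"

text \<open>Within a row, the entries k and k + 1 among the first j columns fill a contiguous
  stretch. The boundary between the two letters is moved to \<open>toggle\<close>.\<close>

definition bk :: "(nat \<Rightarrow> nat) \<Rightarrow> nat \<Rightarrow> nat \<Rightarrow> (nat \<Rightarrow> nat \<Rightarrow> nat) \<Rightarrow> nat \<Rightarrow> nat \<Rightarrow> nat" where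
  "bk lam k j T r c = (if c < lam r \<and> c < j \<and> (T r c = k \<or> T r c = k + 1)
     then (if c < toggle lam T j k r then k else k + 1) else T r c)"

lemma down_closed_eq_lessThan_card:
  fixes S :: "nat set"
  assumes "finite S" and "\<And>x y. x \<in> S \<Longrightarrow> y \<le> x \<Longrightarrow> y \<in> S"
  shows "S = {..<card S}"
proof (cases "S = {}")
  case False
  have "S = {..Max S}"
  proof
    show "S \<subseteq> {..Max S}"
      using Max_ge[OF assms(1)] by blast
    show "{..Max S} \<subseteq> S"
      using assms(2)[OF Max_in[OF assms(1) False]] by blast
  qed
  then show ?thesis
    by (metis card_atMost lessThan_Suc_atMost)
qed simp

text \<open>Rows increase weakly, so the counted columns form an initial segment, and the
  cardinality is the position of a cut.\<close>

lemma row_upto_iff: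
  assumes T: "T \<in> SSYT lam"
  shows "c < row_upto lam T j i r \<longleftrightarrow> c < lam r \<and> c < j \<and> T r c \<le> i"
proof -
  let ?S = "{c. c < lam r \<and> c < j \<and> T r c \<le> i}"
  have "y \<in> ?S" if "x \<in> ?S" "y \<le> x" for x y
    using that SSYT_row[OF T, of y x r] by auto
  moreover have "finite ?S"
    by simp
  ultimately have "?S = {..<card ?S}"
    by (rule down_closed_eq_lessThan_card[rotated])
  then show ?thesis
    unfolding row_upto_def by blast
qed

lemma le_iff_all_less: "(a::nat) \<le> b \<longleftrightarrow> (\<forall>c. c < a \<longrightarrow> c < b)"
  by (meson dual_order.strict_trans1 linorder_not_le order_less_irrefl)

context
  fixes lam :: "nat \<Rightarrow> nat" and T :: "nat \<Rightarrow> nat \<Rightarrow> nat" and k j :: nat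
  assumes lam: "lam \<in> partitions" and T: "T \<in> SSYT lam" and k: "1 \<le> k"
begin

lemma row_upto_mono: "i \<le> i' \<Longrightarrow> row_upto lam T j i r \<le> row_upto lam T j i' r"
  unfolding le_iff_all_less[of "row_upto lam T j i r"] row_upto_iff[OF T] by auto

text \<open>The entry above a cell is strictly smaller. The comparison is made column by column, so
  it survives the restriction to the first j columns.\<close>

lemma row_upto_interlace:
  assumes "1 \<le> i"
  shows "row_upto lam T j i (Suc r) \<le> row_upto lam T j (i - 1) r"
  unfolding le_iff_all_less[of "row_upto lam T j i (Suc r)"] row_upto_iff[OF T]
proof safe
  fix c assume c: "c < lam (Suc r)" "c < j" "T (Suc r) c \<le> i"
  show "c < lam r"
    using c partitions_antimono[OF lam, of r "Suc r"] by simp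
  show "T r c \<le> i - 1"
    using c SSYT_col[OF T, of r "Suc r" c] by simp
qed

lemma tog_bounds: "tog_lo lam T j k r \<le> row_upto lam T j k r" "row_upto lam T j k r \<le> tog_hi lam T j k r"
proof -
  show "tog_lo lam T j k r \<le> row_upto lam T j k r"
    unfolding tog_lo_def
    using row_upto_mono[of "k - 1" k r] row_upto_interlace[of "k + 1" r] by simp
  show "row_upto lam T j k r \<le> tog_hi lam T j k r"
    unfolding tog_hi_def
    using row_upto_mono[of k "k + 1"] row_upto_interlace[OF k] by (auto split: nat.split)
qed

lemma toggle_bounds: "tog_lo lam T j k r \<le> toggle lam T j k r" "toggle lam T j k r \<le> tog_hi lam T j k r"
  using tog_bounds[of r] unfolding toggle_def by auto

lemma toggle_simple_bounds:
  "row_upto lam T j (k - 1) r \<le> toggle lam T j k r" "toggle lam T j k r \<le> row_upto lam T j (k + 1) r"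
  "row_upto lam T j (k + 1) (Suc r) \<le> toggle lam T j k r"
  "toggle lam T j k (Suc r) \<le> row_upto lam T j (k - 1) r"
proof -
  show "row_upto lam T j (k - 1) r \<le> toggle lam T j k r" "row_upto lam T j (k + 1) (Suc r) \<le> toggle lam T j k r"
    using toggle_bounds(1)[of r] by (auto simp: tog_lo_def)
  show "toggle lam T j k r \<le> row_upto lam T j (k + 1) r"
    using toggle_bounds(2)[of r] by (auto simp: tog_hi_def split: nat.splits)
  show "toggle lam T j k (Suc r) \<le> row_upto lam T j (k - 1) r"
    using toggle_bounds(2)[of "Suc r"] by (auto simp: tog_hi_def)
qed

text \<open>The hypothesis guards the border between columns j - 1 and j: an entry k left of it may
  become k + 1, which would break the row if column j had k there.\<close>

lemma bk_SSYT:
  assumes no_k: "\<And>r. j < lam r \<Longrightarrow> T r j \<noteq> k"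
  shows "bk lam k j T \<in> SSYT lam"
proof (rule SSYTI[OF lam])
  show "1 \<le> bk lam k j T r c" if "c < lam r" for r c
    using that k SSYT_pos[OF T that] by (auto simp: bk_def)
  show "bk lam k j T r c = 0" if "lam r \<le> c" for r c
    using that SSYT_out[OF T that] by (auto simp: bk_def)
  show "bk lam k j T r c \<le> bk lam k j T r (Suc c)" if "Suc c < lam r" for r c
  proof -
    have le: "T r c \<le> T r (Suc c)"
      using SSYT_row[OF T, of c "Suc c" r] that by simp
    show ?thesis
    proof (cases "Suc c = j")
      case True
      then have "T r (Suc c) \<noteq> k"
        using no_k that by simp
      then show ?thesis
        using le True by (auto simp: bk_def)
    next
      case False
      then show ?thesis
        using le that by (auto simp: bk_def)
    qed
  qed
  show "bk lam k j T r c < bk lam k j T (Suc r) c" if c: "c < lam (Suc r)" for r c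
  proof -
    have lt: "T r c < T (Suc r) c"
      using SSYT_col[OF T, of r "Suc r" c] c by simp
    have c': "c < lam r"
      using partitions_antimono[OF lam, of r "Suc r"] c by simp
    show ?thesis
    \<comment> \<open>A vertical pair k over k + 1 is the only one at risk. The two interlacing
      bounds on \<open>toggle\<close> keep the upper entry at k and the lower one at k + 1.\<close>
    proof (cases "c < j \<and> T r c = k \<and> T (Suc r) c = k + 1")
      case True
      then have "c < row_upto lam T j (k + 1) (Suc r)"
        using c by (simp add: row_upto_iff[OF T])
      then have "c < toggle lam T j k r"
        using toggle_simple_bounds(3)[of r] by simp
      moreover have "\<not> c < row_upto lam T j (k - 1) r"
        using True k by (auto simp: row_upto_iff[OF T])
      then have "\<not> c < toggle lam T j k (Suc r)"
        using toggle_simple_bounds(4)[of r] by simp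
      ultimately show ?thesis
        using True c c' by (auto simp: bk_def)
    next
      case False
      then show ?thesis
        using lt c c' by (auto simp: bk_def)
    qed
  qed
qed

lemma bk_bound:
  assumes "\<And>r c. c < lam r \<Longrightarrow> T r c \<le> n" "k + 1 \<le> n"
  shows "c < lam r \<Longrightarrow> bk lam k j T r c \<le> n"
  using assms by (auto simp: bk_def)

lemma row_upto_bk:
  "row_upto lam (bk lam k j T) j i r = (if i = k then toggle lam T j k r else row_upto lam T j i r)"
proof (cases "i = k")
  case False
  then have "{c. c < lam r \<and> c < j \<and> bk lam k j T r c \<le> i} = {c. c < lam r \<and> c < j \<and> T r c \<le> i}"
    by (auto simp: bk_def)
  then show ?thesis
    using False by (simp add: row_upto_def)
next
  case True
  \<comment> \<open>Left of the cut of k - 1 and right of the cut of k + 1 nothing changes. As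
    \<open>toggle\<close> lies between these cuts, it becomes the new cut of k.\<close>
  have "{c. c < lam r \<and> c < j \<and> bk lam k j T r c \<le> k} = {..<toggle lam T j k r}" (is "?L = ?R")
  proof (intro set_eqI)
    fix c
    consider "c < row_upto lam T j (k - 1) r" | "\<not> c < row_upto lam T j (k - 1) r" "c < row_upto lam T j (k + 1) r"
      | "\<not> c < row_upto lam T j (k + 1) r"
      by blast
    then show "c \<in> ?L \<longleftrightarrow> c \<in> ?R"
    proof cases
      case 1
      then have "c < lam r" "c < j" "T r c < k" using k by (auto simp: row_upto_iff[OF T])
      with 1 show ?thesis using toggle_simple_bounds(1)[of r] by (auto simp: bk_def)
    next
      case 2
      then have "c < lam r" "c < j" "T r c = k \<or> T r c = k + 1" using k by (auto simp: row_upto_iff[OF T])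
      then show ?thesis by (auto simp: bk_def)
    next
      case 3
      then have "\<not> c < toggle lam T j k r"
        using toggle_simple_bounds(2)[of r] by simp
      moreover have "c \<notin> ?L"
        using 3 by (auto simp: row_upto_iff[OF T] bk_def)
      ultimately show ?thesis by simp
    qed
  qed
  then show ?thesis
    using True by (simp add: row_upto_def)
qed

text \<open>The interval depends on the rows of k - 1 and k + 1 only, which \<open>bk\<close>
  preserves, and a reflection applied twice is the identity.\<close>

lemma toggle_bk: "toggle lam (bk lam k j T) j k r = row_upto lam T j k r"
proof -
  have "k - 1 \<noteq> k" "k + 1 \<noteq> k"
    using k by simp_all
  note * = this
  have lo: "tog_lo lam (bk lam k j T) j k r = tog_lo lam T j k r"
    unfolding tog_lo_def row_upto_bk using * by simp
  have hi: "tog_hi lam (bk lam k j T) j k r = tog_hi lam T j k r"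
    unfolding tog_hi_def row_upto_bk using * by (simp split: nat.split)
  show ?thesis
    unfolding toggle_def[of _ "bk lam k j T"] lo hi row_upto_bk
    using tog_bounds[of r] by (simp add: toggle_def)
qed

lemma bk_bk: "bk lam k j (bk lam k j T) = T"
proof (intro ext)
  fix r c
  show "bk lam k j (bk lam k j T) r c = T r c"
  proof (cases "c < lam r \<and> c < j \<and> (T r c = k \<or> T r c = k + 1)")
    case True
    then have "bk lam k j T r c = k \<or> bk lam k j T r c = k + 1"
      by (simp add: bk_def)
    then have "bk lam k j (bk lam k j T) r c = (if c < row_upto lam T j k r then k else k + 1)"
      using True unfolding bk_def[of lam k j "bk lam k j T"] toggle_bk by simp
    then show ?thesis
      using True by (auto simp: row_upto_iff[OF T])
  next
    case False
    then have "bk lam k j T r c = T r c"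
      by (auto simp: bk_def)
    then show ?thesis
      using False unfolding bk_def[of lam k j "bk lam k j T"] by auto
  qed
qed

end

section \<open>Letter counts under the toggle\<close>

lemma head_count_eq_sum:
  assumes T: "T \<in> SSYT lam" and lam: "lam \<in> partitions" and R: "\<And>r. R \<le> r \<Longrightarrow> lam r = 0" and i: "1 \<le> i"
  shows "head_count lam T j i = (\<Sum>r<R. row_upto lam T j i r - row_upto lam T j (i - 1) r)"
proof -
  have "{x \<in> cells lam. snd x < j \<and> T (fst x) (snd x) = i} =
    Sigma {..<R} (\<lambda>r. {row_upto lam T j (i - 1) r..<row_upto lam T j i r})"
  proof (intro set_eqI iffI)
    fix x assume "x \<in> {x \<in> cells lam. snd x < j \<and> T (fst x) (snd x) = i}"
    then obtain r c where x: "x = (r, c)" "c < lam r" "c < j" "T r c = i"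
      by (auto simp: cells_def)
    moreover have "r < R"
      using R[of r] x by (cases "r < R") auto
    ultimately show "x \<in> Sigma {..<R} (\<lambda>r. {row_upto lam T j (i - 1) r..<row_upto lam T j i r})"
      using i row_upto_iff[OF T] by (auto simp: not_less[symmetric])
  next
    fix x assume "x \<in> Sigma {..<R} (\<lambda>r. {row_upto lam T j (i - 1) r..<row_upto lam T j i r})"
    then obtain r c where x: "x = (r, c)" "\<not> c < row_upto lam T j (i - 1) r" "c < row_upto lam T j i r"
      by auto
    then show "x \<in> {x \<in> cells lam. snd x < j \<and> T (fst x) (snd x) = i}"
      unfolding row_upto_iff[OF T] by (auto simp: cells_def)
  qed
  then show ?thesis
    unfolding head_count_def by simp
qed

text \<open>The maximum in \<open>tog_lo\<close> at row r and the minimum in \<open>tog_hi\<close>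
  at row r + 1 involve the same two numbers, so together they give their sum.\<close>

lemma tog_sum:
  assumes T: "T \<in> SSYT lam" and R: "\<And>r. R \<le> r \<Longrightarrow> lam r = 0"
  shows "(\<Sum>r<R. tog_lo lam T j k r + tog_hi lam T j k r) =
    (\<Sum>r<R. row_upto lam T j (k + 1) r + row_upto lam T j (k - 1) r)"
proof -
  let ?m = "row_upto lam T j"
  have max_plus_min: "max a b + min b a = a + b" for a b :: nat
    by (simp add: max_def min_def)
  \<comment> \<open>The extra terms are the minimum at row N still waiting for its partner. They
    vanish at N = R because row R is empty.\<close>
  have "(\<Sum>r<N. tog_lo lam T j k r + tog_hi lam T j k r) + min (?m (k + 1) N) (if N = 0 then ?m (k + 1) 0 else ?m (k - 1) (N - 1))
     = (\<Sum>r<N. ?m (k + 1) r + ?m (k - 1) r) + ?m (k + 1) N" for N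
  proof (induction N)
    case (Suc N)
    have "tog_hi lam T j k N = min (?m (k + 1) N) (if N = 0 then ?m (k + 1) 0 else ?m (k - 1) (N - 1))"
      by (cases N) (simp_all add: tog_hi_def)
    then show ?case
      using Suc max_plus_min[of "?m (k - 1) N" "?m (k + 1) (Suc N)"] by (simp add: tog_lo_def)
  qed simp
  from this[of R] show ?thesis
    using R[of R] by (simp add: row_upto_def)
qed

text \<open>By \<open>tog_sum\<close>, the old and new row sums for k add up to those for k - 1 and
  k + 1. Hence the new number of letters k is the old number of letters k + 1, and
  conversely.\<close>

lemma head_count_bk:
  assumes lam: "lam \<in> partitions" and T: "T \<in> SSYT lam" and k: "1 \<le> k"
    and no_k: "\<And>r. j < lam r \<Longrightarrow> T r j \<noteq> k"
  shows "1 \<le> i \<Longrightarrow> head_count lam (bk lam k j T) j i = head_count lam T j (Transposition.transpose k (k + 1) i)"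
proof -
  obtain R where R: "\<And>r. R \<le> r \<Longrightarrow> lam r = 0"
    using partitions_eventually_0[OF lam] by blast
  let ?m = "row_upto lam T j"
  have bkS: "bk lam k j T \<in> SSYT lam"
    by (rule bk_SSYT[OF lam T k no_k])
  note up = row_upto_bk[OF lam T k]
  have hcb: "head_count lam (bk lam k j T) j i = (\<Sum>r<R. row_upto lam (bk lam k j T) j i r - row_upto lam (bk lam k j T) j (i - 1) r)"
    if "1 \<le> i" for i
    by (rule head_count_eq_sum[OF bkS lam _ that]) (rule R)
  have hc: "head_count lam T j i = (\<Sum>r<R. ?m i r - ?m (i - 1) r)" if "1 \<le> i" for i
    by (rule head_count_eq_sum[OF T lam _ that]) (rule R)
  note tb = toggle_simple_bounds[OF lam T k]
  note rm = row_upto_mono[OF lam T k]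
  note tob = tog_bounds[OF lam T k]
  have tog: "(\<Sum>r<R. toggle lam T j k r) + (\<Sum>r<R. ?m k r) = (\<Sum>r<R. ?m (k + 1) r) + (\<Sum>r<R. ?m (k - 1) r)"
  proof -
    have "toggle lam T j k r + ?m k r = tog_lo lam T j k r + tog_hi lam T j k r" for r
      using tob[of j r] unfolding toggle_def by simp
    then show ?thesis
      using tog_sum[OF T, of R j k] R by (simp flip: sum.distrib)
  qed
  have k': "k - 1 \<noteq> k" using k by simp
  have sub: "(\<Sum>r<R. f r - g r) = (\<Sum>r<R. f r) - (\<Sum>r<R. g r)" if "\<And>r. g r \<le> f r" for f g :: "nat \<Rightarrow> nat"
    by (rule sum_subtractf_nat) (use that in simp)
  have hck: "head_count lam T j (k + 1) = (\<Sum>r<R. ?m (k + 1) r - ?m k r)"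
    using hc[of "k + 1"] by simp
  have hcbk: "head_count lam (bk lam k j T) j (k + 1) =
      (\<Sum>r<R. row_upto lam (bk lam k j T) j (k + 1) r - row_upto lam (bk lam k j T) j k r)"
    using hcb[of "k + 1"] by simp
  have k1: "head_count lam (bk lam k j T) j k = head_count lam T j (k + 1)"
    unfolding hcb[OF k] hck up using k k' tog tb(1)[of j] rm[of k "k + 1" j]
    by (simp add: sub)
  have k2: "head_count lam (bk lam k j T) j (k + 1) = head_count lam T j k"
    unfolding hcbk hc[OF k] up using k k' tog tb(2)[of j] rm[of "k - 1" "k" j]
    by (simp add: sub)
  have k3: "head_count lam (bk lam k j T) j i = head_count lam T j i" if "i \<noteq> k" "i \<noteq> k + 1" for i
  proof -
    have "{x \<in> cells lam. snd x < j \<and> bk lam k j T (fst x) (snd x) = i} = {x \<in> cells lam. snd x < j \<and> T (fst x) (snd x) = i}"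
      using that by (auto simp: bk_def)
    then show ?thesis
      by (simp add: head_count_def)
  qed
  assume "1 \<le> i"
  then show ?thesis
    using k1 k2 k3 unfolding Transposition.transpose_def by auto
qed

lemma tail_count_bk:
  assumes "j \<le> j'"
  shows "tail_count lam (bk lam k j T) j' i = tail_count lam T j' i"
proof -
  have "{x \<in> cells lam. j' \<le> snd x \<and> bk lam k j T (fst x) (snd x) = i} = {x \<in> cells lam. j' \<le> snd x \<and> T (fst x) (snd x) = i}"
    using assms by (auto simp: bk_def)
  then show ?thesis
    by (simp add: tail_count_def)
qed


subsection \<open>Alternants\<close>

text \<open>Exponents are plain functions, so that permutations act by composition. Passing through
  \<open>Abs_poly_mapping\<close> is the source of the finiteness conditions below.\<close>

definition mon :: "int \<Rightarrow> (nat \<Rightarrow> nat) \<Rightarrow> (nat \<Rightarrow>\<^sub>0 nat) \<Rightarrow>\<^sub>0 int" where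
  "mon s e = Poly_Mapping.single (Abs_poly_mapping e) s"

definition alternant :: "nat \<Rightarrow> (nat \<Rightarrow> nat) \<Rightarrow> (nat \<Rightarrow>\<^sub>0 nat) \<Rightarrow>\<^sub>0 int" where
  "alternant n e = (\<Sum>w | w permutes {1..n}. mon (sign w) (e \<circ> w))"

definition SSYT_le :: "nat \<Rightarrow> (nat \<Rightarrow> nat) \<Rightarrow> (nat \<Rightarrow> nat \<Rightarrow> nat) set" where
  "SSYT_le n lam = {T \<in> SSYT lam. \<forall>(r, c)\<in>cells lam. T r c \<le> n}"

lemma mon_mult:
  assumes "finite {i. e i \<noteq> 0}" "finite {i. f i \<noteq> 0}"
  shows "mon s e * mon s' f = mon (s * s') (\<lambda>i. e i + f i)"
proof -
  have "{i. e i + f i \<noteq> 0} \<subseteq> {i. e i \<noteq> 0} \<union> {i. f i \<noteq> 0}"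
    by auto
  then have "finite {i. e i + f i \<noteq> 0}"
    using assms by (meson finite_UnI finite_subset)
  then have "Abs_poly_mapping e + Abs_poly_mapping f = Abs_poly_mapping (\<lambda>i. e i + f i)"
    using assms by (intro poly_mapping_eqI) (simp add: lookup_add)
  then show ?thesis
    unfolding mon_def mult_single by simp
qed

lemma mon_uminus: "mon (- s) e = - mon s e"
  by (simp add: mon_def single_uminus)

lemma lookup_mon:
  assumes "finite {i. e i \<noteq> 0}" "finite {i. f i \<noteq> 0}"
  shows "Poly_Mapping.lookup (mon s e) (Abs_poly_mapping f) = (if e = f then s else 0)"
proof -
  have "Abs_poly_mapping e = Abs_poly_mapping f \<longleftrightarrow> e = f"
    using assms by (metis lookup_Abs_poly_mapping)
  then show ?thesis
    by (simp add: mon_def lookup_single when_def)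
qed

lemma SSYT_leD: "T \<in> SSYT_le n lam \<Longrightarrow> T \<in> SSYT lam"
  and SSYT_le_bound: "T \<in> SSYT_le n lam \<Longrightarrow> c < lam r \<Longrightarrow> T r c \<le> n"
  by (auto simp: SSYT_le_def cells_def)

lemma SSYT_leI: "T \<in> SSYT lam \<Longrightarrow> (\<And>r c. c < lam r \<Longrightarrow> T r c \<le> n) \<Longrightarrow> T \<in> SSYT_le n lam"
  by (auto simp: SSYT_le_def cells_def)

lemma finite_SSYT_le:
  assumes "lam \<in> partitions"
  shows "finite (SSYT_le n lam)"
proof -
  have fin: "finite {f. \<forall>x. (x \<in> cells lam \<longrightarrow> f x \<in> {..n}) \<and> (x \<notin> cells lam \<longrightarrow> f x = 0)}"
    by (rule finite_set_of_finite_funs) (simp_all add: finite_cells[OF assms])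
  have "(\<lambda>T. \<lambda>x. T (fst x) (snd x)) ` SSYT_le n lam \<subseteq>
      {f. \<forall>x. (x \<in> cells lam \<longrightarrow> f x \<in> {..n}) \<and> (x \<notin> cells lam \<longrightarrow> f x = 0)}"
    unfolding SSYT_le_def SSYT_def by auto
  then have "finite ((\<lambda>T. \<lambda>x. T (fst x) (snd x)) ` SSYT_le n lam)"
    using fin by (rule finite_subset)
  moreover have "inj_on (\<lambda>T. \<lambda>x. T (fst x) (snd x)) (SSYT_le n lam)"
    by (rule inj_onI) (metis ext fst_conv snd_conv)
  ultimately show ?thesis
    by (rule finite_imageD)
qed

section \<open>Contents and Schur polynomials as sums over tableaux\<close>

lemma letter_count_pos_iff:
  assumes "lam \<in> partitions"
  shows "letter_count lam T i \<noteq> 0 \<longleftrightarrow> (\<exists>r c. c < lam r \<and> T r c = i)"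
  using finite_cells[OF assms] by (auto simp: letter_count_def card_eq_0_iff cells_def)

lemma letter_count_0: "T \<in> SSYT lam \<Longrightarrow> lam \<in> partitions \<Longrightarrow> letter_count lam T 0 = 0"
  using letter_count_pos_iff[of lam T 0] SSYT_pos by fastforce

lemma letter_count_support:
  assumes "lam \<in> partitions" "T \<in> SSYT_le n lam"
  shows "{i. letter_count lam T i \<noteq> 0} \<subseteq> {1..n}"
  using letter_count_pos_iff[OF assms(1)] SSYT_pos[OF SSYT_leD[OF assms(2)]] SSYT_le_bound[OF assms(2)] by auto

lemma monomial_of_eq_mon:
  assumes lam: "lam \<in> partitions"
  shows "monomial_of lam T = mon 1 (letter_count lam T)"
proof -
  have fin: "finite (cells lam)"
    by (rule finite_cells[OF lam])
  have "{i. letter_count lam T i \<noteq> 0} \<subseteq> (\<lambda>(r, c). T r c) ` cells lam"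
    unfolding letter_count_pos_iff[OF lam] by (force simp: cells_def)
  then have fin': "finite {i. letter_count lam T i \<noteq> 0}"
    using fin by (meson finite_imageI finite_subset)
  have "(\<Sum>(r, c)\<in>cells lam. Poly_Mapping.single (T r c) 1) = Abs_poly_mapping (letter_count lam T)"
  proof (rule poly_mapping_eqI)
    fix i
    have "Poly_Mapping.lookup (\<Sum>(r, c)\<in>cells lam. Poly_Mapping.single (T r c) (1::nat)) i =
        (\<Sum>x\<in>cells lam. if T (fst x) (snd x) = i then 1 else 0)"
      unfolding lookup_sum by (intro sum.cong) (auto simp: lookup_single when_def split: prod.splits)
    also have "\<dots> = letter_count lam T i"
      unfolding letter_count_def using fin by (simp add: sum.If_cases Int_def)
    finally show "Poly_Mapping.lookup (\<Sum>(r, c)\<in>cells lam. Poly_Mapping.single (T r c) 1) i = Poly_Mapping.lookup (Abs_poly_mapping (letter_count lam T)) i"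
      using fin' by simp
  qed
  then show ?thesis
    by (simp add: monomial_of_def mon_def)
qed

lemma schur_eq:
  assumes "lam \<in> partitions"
  shows "schur n lam = (\<Sum>T\<in>SSYT_le n lam. mon 1 (letter_count lam T))"
  unfolding schur_def SSYT_le_def[symmetric] monomial_of_eq_mon[OF assms] ..

lemma schur_eq_0:
  assumes "lam \<in> partitions" "lam n \<noteq> 0"
  shows "schur n lam = 0"
proof -
  have "SSYT_le n lam = {}"
  proof (rule ccontr)
    assume "SSYT_le n lam \<noteq> {}"
    then obtain T where T: "T \<in> SSYT_le n lam"
      by blast
    have "n < T n 0"
      using SSYT_entry_gt_row[OF SSYT_leD[OF T] assms(1), of 0 n] assms(2) by simp
    then show False
      using SSYT_le_bound[OF T, of 0 n] assms(2) by simp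
  qed
  then show ?thesis
    unfolding schur_eq[OF assms(1)] by simp
qed

text \<open>With j = \<open>lam 0\<close> every column belongs to the head and the condition on
  column j is vacuous: this is the classical Bender-Knuth involution.\<close>

lemma letter_count_bk_full:
  assumes lam: "lam \<in> partitions" and T: "T \<in> SSYT lam" and k: "1 \<le> k"
  shows "letter_count lam (bk lam k (lam 0) T) = letter_count lam T \<circ> Transposition.transpose k (k + 1)"
    and "bk lam k (lam 0) T \<in> SSYT lam"
proof -
  have no_k: "T r (lam 0) \<noteq> k" if "lam 0 < lam r" for r
    using that partitions_antimono[OF lam, of 0 r] by simp
  show bkS: "bk lam k (lam 0) T \<in> SSYT lam"
    by (rule bk_SSYT[OF lam T k no_k])
  have eq: "letter_count lam U i = head_count lam U (lam 0) i" for U i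
    using letter_count_split[OF lam, of U i "lam 0"] tail_count_beyond[OF lam order_refl] by simp
  have "letter_count lam (bk lam k (lam 0) T) i = letter_count lam T (Transposition.transpose k (k + 1) i)" for i
  proof (cases "i = 0")
    case True
    then show ?thesis
      using k letter_count_0[OF T lam] letter_count_0[OF bkS lam] by (simp add: Transposition.transpose_def)
  next
    case False
    then show ?thesis
      unfolding eq by (intro head_count_bk[OF lam T k no_k]) simp_all
  qed
  then show "letter_count lam (bk lam k (lam 0) T) = letter_count lam T \<circ> Transposition.transpose k (k + 1)"
    by auto
qed

text \<open>\<open>P v\<close> asks for some bijection of the tableaux that permutes contents by v.
  This is closed under composition and holds for adjacent transpositions. Only existence is asked
  for: Bender-Knuth involutions violate the braid relations, so they define no action of the
  symmetric group.\<close>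

lemma schur_symmetric:
  assumes lam: "lam \<in> partitions" and w: "w permutes {1..n}"
  shows "schur n lam = (\<Sum>T\<in>SSYT_le n lam. mon 1 (letter_count lam T \<circ> w))"
proof -
  let ?S = "SSYT_le n lam"
  define P where "P v \<longleftrightarrow> (\<exists>g. bij_betw g ?S ?S \<and> (\<forall>T\<in>?S. letter_count lam (g T) = letter_count lam T \<circ> v))" for v
  have P_id: "P id"
    unfolding P_def by (rule exI[of _ id]) simp
  have P_comp: "P (u \<circ> v)" if u: "P u" and v: "P v" for u v
  proof -
    from u obtain g where g: "bij_betw g ?S ?S" "\<And>T. T \<in> ?S \<Longrightarrow> letter_count lam (g T) = letter_count lam T \<circ> u"
      unfolding P_def by blast
    from v obtain h where h: "bij_betw h ?S ?S" "\<And>T. T \<in> ?S \<Longrightarrow> letter_count lam (h T) = letter_count lam T \<circ> v"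
      unfolding P_def by blast
    have "letter_count lam ((h \<circ> g) T) = letter_count lam T \<circ> (u \<circ> v)" if "T \<in> ?S" for T
    proof -
      have "g T \<in> ?S"
        using g(1) that by (rule bij_betwE[rule_format])
      then show ?thesis
        using g(2)[OF that] h(2)[of "g T"] by (simp add: comp_assoc)
    qed
    then show ?thesis
      unfolding P_def using bij_betw_trans[OF g(1) h(1)] by blast
  qed
  have P_adj: "P (Transposition.transpose k (k + 1))" if k: "1 \<le> k" "k + 1 \<le> n" for k
  proof -
    let ?g = "bk lam k (lam 0)"
    have g: "?g T \<in> ?S" if T: "T \<in> ?S" for T
      using letter_count_bk_full(2)[OF lam SSYT_leD[OF T] k(1)] bk_bound[OF lam SSYT_leD[OF T] k(1) _ k(2)]
        SSYT_le_bound[OF T] by (intro SSYT_leI) auto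
    have "bij_betw ?g ?S ?S"
      by (rule bij_betw_byWitness[where f' = ?g]) (use g bk_bk[OF lam SSYT_leD k(1)] in auto)
    then show ?thesis
      unfolding P_def using letter_count_bk_full(1)[OF lam SSYT_leD k(1)] by blast
  qed
  have P_transp: "1 \<le> a \<Longrightarrow> a + Suc d \<le> n \<Longrightarrow> P (Transposition.transpose a (a + Suc d))" for a d
  proof (induction d)
    case 0
    then show ?case using P_adj[of a] by simp
  next
    case (Suc d)
    let ?b = "a + Suc d"
    \<comment> \<open>Conjugation by an adjacent transposition moves the upper point from b to b +
      1.\<close>
    have "Transposition.transpose a (Suc ?b) =
        Transposition.transpose ?b (?b + 1) \<circ> Transposition.transpose a ?b \<circ> Transposition.transpose ?b (?b + 1)"
      by (auto simp: fun_eq_iff Transposition.transpose_def)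
    moreover have "P (Transposition.transpose ?b (?b + 1))"
      using P_adj[of ?b] Suc by simp
    moreover have "P (Transposition.transpose a ?b)"
      using Suc by simp
    ultimately have "P (Transposition.transpose a (Suc ?b))"
      using P_comp by metis
    then show ?case
      by simp
  qed
  have P_transp': "P (Transposition.transpose a b)" if ab: "a \<in> {1..n}" "b \<in> {1..n}" "a \<noteq> b" for a b
  proof (cases "a < b")
    case True
    then obtain d where "b = a + Suc d"
      using less_imp_Suc_add by auto
    then show ?thesis
      using P_transp[of a d] ab by simp
  next
    case False
    then obtain d where "a = b + Suc d"
      using less_imp_Suc_add[of b a] ab(3) by auto
    then show ?thesis
      using P_transp[of b d] ab by (simp add: transpose_commute)
  qed
  have "P w"
    using w finite_atLeastAtMost
  proof (induction rule: permutes_induct)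
    case id
    show ?case by (rule P_id)
  next
    case (swap a b p)
    then show ?case using P_comp P_transp' by blast
  qed
  then obtain g where g: "bij_betw g ?S ?S" "\<And>T. T \<in> ?S \<Longrightarrow> letter_count lam (g T) = letter_count lam T \<circ> w"
    unfolding P_def by blast
  have "schur n lam = (\<Sum>T\<in>?S. mon 1 (letter_count lam (g T)))"
    unfolding schur_eq[OF lam] by (rule sum.reindex_bij_betw[OF g(1), symmetric])
  then show ?thesis
    using g(2) by simp
qed

text \<open>By symmetry, the Schur factor of the summand w can be expanded with all contents
  composed with w. Both exponents then carry the same w, and the two sums are exchanged.\<close>

lemma alternant_mult_schur:
  assumes lam: "lam \<in> partitions" and e: "finite {i. e i \<noteq> 0}"
  shows "alternant n e * schur n lam = (\<Sum>T\<in>SSYT_le n lam. alternant n (\<lambda>i. e i + letter_count lam T i))"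
proof -
  have fin: "finite {i. (f \<circ> w) i \<noteq> 0}" if "finite {i. f i \<noteq> 0}" "w permutes {1..n}" for f :: "nat \<Rightarrow> nat" and w
  proof -
    have "{i. (f \<circ> w) i \<noteq> 0} = w -` {i. f i \<noteq> 0}"
      by auto
    then show ?thesis
      using finite_vimageI[OF that(1) permutes_inj[OF that(2)]] by simp
  qed
  have "alternant n e * schur n lam = (\<Sum>w | w permutes {1..n}. mon (sign w) (e \<circ> w) * schur n lam)"
    unfolding alternant_def by (rule sum_distrib_right)
  also have "\<dots> = (\<Sum>w | w permutes {1..n}. \<Sum>T\<in>SSYT_le n lam. mon (sign w) ((\<lambda>i. e i + letter_count lam T i) \<circ> w))"
  proof (rule sum.cong[OF refl])
    fix w assume "w \<in> {w. w permutes {1..n}}"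
    then have w: "w permutes {1..n}" by simp
    have "mon (sign w) (e \<circ> w) * schur n lam =
      (\<Sum>T\<in>SSYT_le n lam. mon (sign w) (e \<circ> w) * mon 1 (letter_count lam T \<circ> w))"
      unfolding schur_symmetric[OF lam w] by (rule sum_distrib_left)
    also have "\<dots> = (\<Sum>T\<in>SSYT_le n lam. mon (sign w) ((\<lambda>i. e i + letter_count lam T i) \<circ> w))"
    proof (rule sum.cong[OF refl])
      fix T assume T: "T \<in> SSYT_le n lam"
      have "finite {i. letter_count lam T i \<noteq> 0}"
        using letter_count_support[OF lam T] finite_subset by blast
      from mon_mult[OF fin[OF e w] fin[OF this w], of "sign w" 1]
      show "mon (sign w) (e \<circ> w) * mon 1 (letter_count lam T \<circ> w) = mon (sign w) ((\<lambda>i. e i + letter_count lam T i) \<circ> w)"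
        by (simp add: comp_def)
    qed
    finally show "mon (sign w) (e \<circ> w) * schur n lam =
      (\<Sum>T\<in>SSYT_le n lam. mon (sign w) ((\<lambda>i. e i + letter_count lam T i) \<circ> w))" .
  qed
  also have "\<dots> = (\<Sum>T\<in>SSYT_le n lam. alternant n (\<lambda>i. e i + letter_count lam T i))"
    unfolding alternant_def by (rule sum.swap)
  finally show ?thesis .
qed

section \<open>Antisymmetry and leading coefficients of alternants\<close>

lemma alternant_transpose:
  assumes "1 \<le> k" "k + 1 \<le> n"
  shows "alternant n (e \<circ> Transposition.transpose k (k + 1)) = - alternant n e"
proof -
  let ?q = "Transposition.transpose k (k + 1)"
  have q: "?q permutes {1..n}"
    using assms by (intro permutes_swap_id) auto
  have sgn: "sign (?q \<circ> w) = - sign w" if "w permutes {1..n}" for w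
    using sign_compose[OF permutation_swap_id[of k "k + 1"], of w] permutation_permutes that
    by (metis finite_atLeastAtMost mult_minus1 n_not_Suc_n sign_swap_id Suc_eq_plus1)
  have "alternant n e = (\<Sum>w | w permutes {1..n}. mon (sign (?q \<circ> w)) (e \<circ> (?q \<circ> w)))"
    unfolding alternant_def by (rule setum_permutations_compose_left[OF q])
  also have "\<dots> = (\<Sum>w | w permutes {1..n}. - mon (sign w) ((e \<circ> ?q) \<circ> w))"
    by (rule sum.cong[OF refl]) (simp only: mem_Collect_eq sgn mon_uminus comp_assoc)
  also have "\<dots> = - alternant n (e \<circ> ?q)"
    unfolding alternant_def by (simp add: sum_negf)
  finally show ?thesis
    by simp
qed

text \<open>If e and its rearrangement both decrease strictly, w increases strictly on its range.
  Then i is at most w i for every i, which forces the identity.\<close>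

lemma permutes_strict_decreasing:
  fixes e e' :: "nat \<Rightarrow> nat"
  assumes w: "w permutes {1..n}" and eq: "e \<circ> w = e'"
    and e: "\<And>i j. 1 \<le> i \<Longrightarrow> i < j \<Longrightarrow> j \<le> n \<Longrightarrow> e j < e i"
    and e': "\<And>i j. 1 \<le> i \<Longrightarrow> i < j \<Longrightarrow> j \<le> n \<Longrightarrow> e' j < e' i"
  shows "w = id"
proof (rule permutes_natset_ge[OF w], intro ballI)
  fix i assume i: "i \<in> {1..n}"
  have "1 \<le> i \<Longrightarrow> i \<le> n \<Longrightarrow> i \<le> w i"
  proof (induction i rule: dec_induct)
    case base
    then show ?case
      using permutes_in_image[OF w, of 1] by auto
  next
    case (step i)
    have in_range: "w i \<in> {1..n}" "w (Suc i) \<in> {1..n}"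
      using permutes_in_image[OF w, of i] permutes_in_image[OF w, of "Suc i"] step(1) step(4) by simp_all
    have "e (w (Suc i)) < e (w i)"
      using e'[of i "Suc i"] step(1) step(4) unfolding eq[symmetric] comp_def by simp
    then have "w i < w (Suc i)"
    proof (rule contrapos_pp)
      assume "\<not> w i < w (Suc i)"
      then consider "w (Suc i) < w i" | "w i = w (Suc i)"
        by linarith
      then show "\<not> e (w (Suc i)) < e (w i)"
      proof cases
        case 1
        then show ?thesis
          using e[of "w (Suc i)" "w i"] in_range by simp
      next
        case 2
        then show ?thesis
          by simp
      qed
    qed
    then show ?case
      using step by simp
  qed
  then show "i \<le> w i"
    using i by simp
qed

text \<open>This is the linear independence of alternants: only the identity permutation can produce
  a strictly decreasing exponent.\<close>

lemma lookup_alternant: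
  assumes e: "\<And>i j. 1 \<le> i \<Longrightarrow> i < j \<Longrightarrow> j \<le> n \<Longrightarrow> e j < e i" "finite {i. e i \<noteq> 0}"
    and e': "\<And>i j. 1 \<le> i \<Longrightarrow> i < j \<Longrightarrow> j \<le> n \<Longrightarrow> e' j < e' i" "finite {i. e' i \<noteq> 0}"
  shows "Poly_Mapping.lookup (alternant n e) (Abs_poly_mapping e') = (if e = e' then 1 else 0)"
proof -
  have "Poly_Mapping.lookup (alternant n e) (Abs_poly_mapping e') =
      (\<Sum>w | w permutes {1..n}. if w = id then (if e = e' then 1 else 0) else 0)"
    unfolding alternant_def lookup_sum
  proof (rule sum.cong[OF refl])
    fix w assume "w \<in> {w. w permutes {1..n}}"
    then have w: "w permutes {1..n}" by simp
    have "{i. (e \<circ> w) i \<noteq> 0} = w -` {i. e i \<noteq> 0}"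
      by auto
    then have "finite {i. (e \<circ> w) i \<noteq> 0}"
      using finite_vimageI[OF e(2) permutes_inj[OF w]] by simp
    then have "Poly_Mapping.lookup (mon (sign w) (e \<circ> w)) (Abs_poly_mapping e') = (if e \<circ> w = e' then sign w else 0)"
      using e'(2) by (rule lookup_mon)
    moreover have wid: "w = id" if "e \<circ> w = e'"
      by (rule permutes_strict_decreasing[OF w that]) (fact e(1), fact e'(1))
    ultimately show "Poly_Mapping.lookup (mon (sign w) (e \<circ> w)) (Abs_poly_mapping e') = (if w = id then (if e = e' then 1 else 0) else 0)"
      using wid by auto
  qed
  also have "\<dots> = (if e = e' then 1 else 0)"
    using permutes_id[of "{1..n}"] by (simp add: finite_permutations)
  finally show ?thesis .
qed

subsection \<open>The Littlewood--Richardson rule\<close>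

text \<open>The Littlewood-Richardson condition: \<delta> plus the content of the columns from j on
  stays weakly decreasing for each j. Letter i goes to row i - 1. Whole columns suffice because
  within a column i is read before i + 1.\<close>

definition good :: "(nat \<Rightarrow> nat) \<Rightarrow> (nat \<Rightarrow> nat) \<Rightarrow> (nat \<Rightarrow> nat \<Rightarrow> nat) \<Rightarrow> bool" where
  "good \<delta> lam T \<longleftrightarrow>
     (\<forall>j i. 1 \<le> i \<longrightarrow> \<delta> i + tail_count lam T j (i + 1) \<le> \<delta> (i - 1) + tail_count lam T j i)"

text \<open>The exponent \<open>\<nu> + \<rho>\<close>, with coordinates numbered by the letters \<open>1, \<dots>, n\<close>.\<close>

definition shifted :: "nat \<Rightarrow> (nat \<Rightarrow> nat) \<Rightarrow> nat \<Rightarrow> nat" where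
  "shifted n \<nu> i = (if 1 \<le> i \<and> i \<le> n then \<nu> (i - 1) + (n - i) else 0)"

definition add_content :: "(nat \<Rightarrow> nat) \<Rightarrow> (nat \<Rightarrow> nat) \<Rightarrow> (nat \<Rightarrow> nat \<Rightarrow> nat) \<Rightarrow> nat \<Rightarrow> nat" where
  "add_content \<delta> lam T j = \<delta> j + letter_count lam T (j + 1)"

lemma shifted_add_content:
  assumes "lam \<in> partitions" "T \<in> SSYT_le n lam"
  shows "(\<lambda>i. shifted n \<delta> i + letter_count lam T i) = shifted n (add_content \<delta> lam T)"
proof
  fix i
  have "letter_count lam T i = 0" if "i \<notin> {1..n}"
    using letter_count_support[OF assms] that by auto
  then show "shifted n \<delta> i + letter_count lam T i = shifted n (add_content \<delta> lam T) i"
    by (auto simp: shifted_def add_content_def)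
qed

lemma finite_shifted: "finite {i. shifted n \<nu> i \<noteq> 0}"
  by (rule finite_subset[of _ "{..n}"]) (auto simp: shifted_def)

lemma shifted_decreasing:
  assumes "\<nu> \<in> partitions" "1 \<le> i" "i < j" "j \<le> n"
  shows "shifted n \<nu> j < shifted n \<nu> i"
proof -
  have "\<nu> (j - 1) \<le> \<nu> (i - 1)"
    using assms(2-) by (intro partitions_antimono[OF assms(1)]) simp
  then show ?thesis
    using assms(2-) by (simp add: shifted_def)
qed

text \<open>A violating tableau is paired with its image under the Bender--Knuth involution applied to the
  columns strictly to the left of the last column \<open>j\<close> at which the condition fails. There the two
  critical entries of \<open>\<delta> + \<rho> + \<close>content of the columns from \<open>j\<close> on coincide, so the involution
  acts on the total exponent by a transposition.\<close>

lemma alternant_violating_sum: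
  assumes lam: "lam \<in> partitions" and dl: "\<delta> \<in> partitions"
  shows "(\<Sum>T | T \<in> SSYT_le n lam \<and> \<not> good \<delta> lam T. alternant n (\<lambda>i. shifted n \<delta> i + letter_count lam T i)) = 0"
proof -
  define viol where "viol T j i \<longleftrightarrow> 1 \<le> i \<and> \<delta> (i - 1) + tail_count lam T j i < \<delta> i + tail_count lam T j (i + 1)"
    for T j i
  \<comment> \<open>J and K are determined by columns from \<open>J T\<close> on, which the
    involution \<open>g\<close> leaves alone. So T and \<open>g T\<close> have the same J and
    K.\<close>
  define J where "J T = (GREATEST j. \<exists>i. viol T j i)" for T
  define K where "K T = (LEAST i. viol T (J T) i)" for T
  define g where "g T = bk lam (K T) (J T) T" for T
  define f where "f T = alternant n (\<lambda>i. shifted n \<delta> i + letter_count lam T i)" for T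
  let ?Bad = "{T. T \<in> SSYT_le n lam \<and> \<not> good \<delta> lam T}"
  have bad_iff: "\<not> good \<delta> lam T \<longleftrightarrow> (\<exists>j i. viol T j i)" for T
    unfolding good_def viol_def by (auto simp: not_le)
  \<comment> \<open>This bound makes \<open>GREATEST\<close> meaningful: beyond the diagram the
    tails are empty and \<delta> itself is weakly decreasing.\<close>
  have viol_bound: "j \<le> lam 0" if "\<exists>i. viol T j i" for T j
  proof (rule ccontr)
    assume "\<not> j \<le> lam 0"
    then have "tail_count lam T j i = 0" for i
      by (intro tail_count_beyond[OF lam]) simp
    with that obtain i where "\<delta> (i - 1) < \<delta> i"
      by (auto simp: viol_def)
    then show False
      using partitions_antimono[OF dl, of "i - 1" i] by simp
  qed
  have key: "g T \<in> ?Bad \<and> g (g T) = T \<and> f (g T) = - f T" if "T \<in> ?Bad" for T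
  proof -
    have T: "T \<in> SSYT_le n lam" "T \<in> SSYT lam" and "\<not> good \<delta> lam T"
      using that SSYT_leD by auto
    then have "\<exists>j i. viol T j i"
      using bad_iff by blast
    then have viol_J: "\<exists>i. viol T (J T) i" and J_max: "\<And>j. \<exists>i. viol T j i \<Longrightarrow> j \<le> J T"
      unfolding J_def using viol_bound GreatestI_ex_nat[of "\<lambda>j. \<exists>i. viol T j i" "lam 0"]
        Greatest_le_nat[of "\<lambda>j. \<exists>i. viol T j i" _ "lam 0"] by blast+
    define j where "j = J T"
    define k where "k = K T"
    have viol_k: "viol T j k"
      using viol_J unfolding j_def k_def K_def by (rule LeastI_ex)
    have k: "1 \<le> k"
      using viol_k by (simp add: viol_def)
    \<comment> \<open>By maximality of j the inequality still holds for the columns from j + 1 on.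
      Column j changes each count by at most one, so it fails by exactly one at j.\<close>
    have "\<not> viol T (Suc j) k"
      using J_max[of "Suc j"] unfolding j_def by auto
    then have step: "\<delta> k + tail_count lam T (Suc j) (k + 1) \<le> \<delta> (k - 1) + tail_count lam T (Suc j) k"
      using k by (auto simp: viol_def)
    have viol_k': "\<delta> (k - 1) + tail_count lam T j k < \<delta> k + tail_count lam T j (k + 1)"
      using viol_k by (simp add: viol_def)
    note tail = tail_count_Suc[OF T(2) lam, of j]
    \<comment> \<open>A letter k in column j would raise the right-hand side too, and the inequality
      would survive. This is the hypothesis of \<open>bk_SSYT\<close>.\<close>
    have no_k: "T r j \<noteq> k" if "j < lam r" for r
    proof
      assume "T r j = k"
      with that have "tail_count lam T j k = tail_count lam T (Suc j) k + 1"
        using tail[of k] by auto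
      moreover have "tail_count lam T j (k + 1) \<le> tail_count lam T (Suc j) (k + 1) + 1"
        using tail[of "k + 1"] by auto
      ultimately show False
        using step viol_k' by linarith
    qed
    have crit: "\<delta> k + tail_count lam T j (k + 1) = \<delta> (k - 1) + tail_count lam T j k + 1"
    proof -
      have "tail_count lam T j k = tail_count lam T (Suc j) k"
        using tail[of k] no_k by auto
      moreover have "tail_count lam T j (k + 1) \<le> tail_count lam T (Suc j) (k + 1) + 1"
        using tail[of "k + 1"] by auto
      ultimately show ?thesis
        using step viol_k' by linarith
    qed
    \<comment> \<open>As \<delta> is weakly decreasing, the violation needs an occurrence of k + 1
      in T. Hence k + 1 is at most n, and the swap acts on the n variables.\<close>
    have "tail_count lam T j (k + 1) \<noteq> 0"
      using viol_k' partitions_antimono[OF dl, of "k - 1" k] by auto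
    then have "letter_count lam T (k + 1) \<noteq> 0"
      using letter_count_split[OF lam, of T "k + 1" j] by simp
    then have kn: "k + 1 \<le> n"
      using letter_count_support[OF lam T(1)] by auto
    have g: "g T = bk lam k j T"
      by (simp add: g_def k_def j_def)
    have gS: "g T \<in> SSYT lam"
      unfolding g by (rule bk_SSYT[OF lam T(2) k no_k])
    have g_le: "g T \<in> SSYT_le n lam"
      using gS bk_bound[OF lam T(2) k SSYT_le_bound[OF T(1)] kn] unfolding g by (rule SSYT_leI)
    have tails: "tail_count lam (g T) j' i = tail_count lam T j' i" if "j \<le> j'" for j' i
      unfolding g by (rule tail_count_bk[OF that])
    have viol_g: "viol (g T) j' i \<longleftrightarrow> viol T j' i" if "j \<le> j'" for j' i
      unfolding viol_def tails[OF that] ..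
    have Jg: "J (g T) = j"
      unfolding J_def
    proof (rule Greatest_equality)
      show "\<exists>i. viol (g T) j i"
        using viol_k viol_g[of j] by blast
      show "j' \<le> j" if "\<exists>i. viol (g T) j' i" for j'
      proof (rule ccontr)
        assume "\<not> j' \<le> j"
        then show False
          using that viol_g[of j'] J_max[of j'] by (auto simp: j_def)
      qed
    qed
    have Kg: "K (g T) = k"
      unfolding K_def Jg viol_g[OF order_refl] by (simp add: k_def K_def j_def)
    have gg: "g (g T) = T"
      unfolding g_def[of "g T"] Jg Kg unfolding g by (rule bk_bk[OF lam T(2) k])
    have "(\<lambda>i. shifted n \<delta> i + letter_count lam (g T) i) =
        (\<lambda>i. shifted n \<delta> i + letter_count lam T i) \<circ> Transposition.transpose k (k + 1)"
    proof
      fix i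
      have heads: "head_count lam (g T) j i = head_count lam T j (Transposition.transpose k (k + 1) i)" if "1 \<le> i" for i
        unfolding g by (rule head_count_bk[OF lam T(2) k no_k that])
      have split: "letter_count lam U i = tail_count lam U j i + head_count lam U j i" for U i
        by (rule letter_count_split[OF lam])
      consider "i = 0" | "i = k" | "i = k + 1" | "i \<noteq> 0" "i \<noteq> k" "i \<noteq> k + 1"
        by blast
      then show "shifted n \<delta> i + letter_count lam (g T) i =
        ((\<lambda>i. shifted n \<delta> i + letter_count lam T i) \<circ> Transposition.transpose k (k + 1)) i"
      proof cases
        case 1
        then show ?thesis
          using k letter_count_0[OF T(2) lam] letter_count_0[OF gS lam] by (simp add: Transposition.transpose_def)
      next
        \<comment> \<open>The staircase gives k one more than k + 1, which absorbs the 1 in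
          \<open>crit\<close>: outside the head the two exponents agree, and the heads are
          swapped.\<close>
        case 2
        then show ?thesis
          using k kn crit heads[OF k] by (simp add: split tails shifted_def)
      next
        case 3
        then show ?thesis
          using k kn crit heads[of "k + 1"] by (simp add: split tails shifted_def)
      next
        case 4
        then show ?thesis
          using heads[of i] by (simp add: split tails Transposition.transpose_def)
      qed
    qed
    then have "f (g T) = - f T"
      unfolding f_def using alternant_transpose[OF k kn] by simp
    moreover have "\<not> good \<delta> lam (g T)"
      using bad_iff viol_k viol_g[of j k] by blast
    ultimately show ?thesis
      using gg g_le by blast
  qed
  have "(\<Sum>T\<in>?Bad. f T) = (\<Sum>T\<in>?Bad. - f T)"
    by (rule sum.reindex_bij_witness[of _ g g]) (use key in auto)
  then have "2 * (\<Sum>T\<in>?Bad. f T) = 0"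
    by (simp add: sum_negf)
  then have "(\<Sum>T\<in>?Bad. f T) = 0"
    by simp
  then show ?thesis
    by (simp add: f_def)
qed

lemma alternant_mult_schur_good:
  assumes lam: "lam \<in> partitions" and dl: "\<delta> \<in> partitions"
  shows "alternant n (shifted n \<delta>) * schur n lam =
    (\<Sum>T | T \<in> SSYT_le n lam \<and> good \<delta> lam T. alternant n (shifted n (add_content \<delta> lam T)))"
proof -
  let ?f = "\<lambda>T. alternant n (\<lambda>i. shifted n \<delta> i + letter_count lam T i)"
  have fin: "finite (SSYT_le n lam)"
    by (rule finite_SSYT_le[OF lam])
  have "alternant n (shifted n \<delta>) * schur n lam = (\<Sum>T\<in>SSYT_le n lam. ?f T)"
    by (rule alternant_mult_schur[OF lam finite_shifted])
  also have "\<dots> = (\<Sum>T | T \<in> SSYT_le n lam \<and> good \<delta> lam T. ?f T) + (\<Sum>T | T \<in> SSYT_le n lam \<and> \<not> good \<delta> lam T. ?f T)"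
  proof -
    have "SSYT_le n lam = {T \<in> SSYT_le n lam. good \<delta> lam T} \<union> {T \<in> SSYT_le n lam. \<not> good \<delta> lam T}"
      by auto
    then show ?thesis
      using fin by (subst sum.union_disjoint[symmetric]) auto
  qed
  also have "\<dots> = (\<Sum>T | T \<in> SSYT_le n lam \<and> good \<delta> lam T. alternant n (shifted n (add_content \<delta> lam T)))"
    unfolding alternant_violating_sum[OF assms] add_0_right
    by (rule sum.cong) (auto simp: shifted_add_content[OF lam])
  finally show ?thesis .
qed

text \<open>Induction goes through the columns from right to left and downwards in each. An entry x
  + 1 that is too large at (r, j) requires a letter x in the columns from j on. To the right, x
  would sit in row x - 1, at or below r, and row r would already have r + 1 there, against weak
  increase. In column j it would sit above row r, where the entries are too small.\<close>

lemma good_zero_entries: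
  assumes lam: "lam \<in> partitions" and T: "T \<in> SSYT lam" and "good (\<lambda>_. 0) lam T"
  shows "c < lam r \<Longrightarrow> T r c = r + 1"
proof -
  have good: "tail_count lam T j (i + 1) \<le> tail_count lam T j i" if "1 \<le> i" for i j
    using assms(3) that by (simp add: good_def)
  have fin: "finite (cells lam)"
    by (rule finite_cells[OF lam])
  \<comment> \<open>d is the number of columns, counted from the right edge, that are already
    settled.\<close>
  have main: "\<forall>r c. lam 0 - d \<le> c \<longrightarrow> c < lam r \<longrightarrow> T r c = r + 1" for d
  proof (induction d)
    case 0
    show ?case
    proof (intro allI impI)
      fix r c assume "lam 0 - 0 \<le> c" "c < lam r"
      then show "T r c = r + 1"
        using partitions_antimono[OF lam, of 0 r] by simp
    qed
  next
    case (Suc d)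
    define j where "j = lam 0 - Suc d"
    have right: "T r c = r + 1" if "j < c" "c < lam r" for r c
      using Suc that by (auto simp: j_def)
    have "T r j = r + 1" if "j < lam r" for r
      using that
    proof (induction r rule: less_induct)
      case (less r)
      show ?case
      proof (rule ccontr)
        assume "T r j \<noteq> r + 1"
        then have gt: "r + 1 < T r j"
          using SSYT_entry_gt_row[OF T lam less.prems] by simp
        define x where "x = T r j - 1"
        have x: "1 \<le> x" "T r j = x + 1" "r + 1 \<le> x"
          using gt by (auto simp: x_def)
        have "{y \<in> cells lam. j \<le> snd y \<and> T (fst y) (snd y) = x + 1} \<noteq> {}"
          using less.prems x by (force simp: cells_def)
        then have "tail_count lam T j (x + 1) \<noteq> 0"
          using fin by (simp add: tail_count_def card_eq_0_iff)
        then have "tail_count lam T j x \<noteq> 0"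
          using good[OF x(1), of j] by simp
        then have "{y \<in> cells lam. j \<le> snd y \<and> T (fst y) (snd y) = x} \<noteq> {}"
          unfolding tail_count_def by (metis card.empty)
        then obtain r' c' where rc: "c' < lam r'" "j \<le> c'" "T r' c' = x"
          by (auto simp: cells_def)
        show False
        proof (cases "j < c'")
          case True
          then have "r' + 1 = x"
            using right[of c' r'] rc by simp
          then have "r \<le> r'"
            using x by simp
          then have c': "c' < lam r"
            using rc partitions_antimono[OF lam, of r r'] by simp
          then have "T r c' = r + 1"
            using right True by simp
          moreover have "T r j \<le> T r c'"
            using SSYT_row[OF T _ c'] True by simp
          ultimately show False
            using gt by simp
        next
          case False
          then have [simp]: "c' = j"
            using rc by simp
          have "r' < r"
          proof (rule ccontr)
            assume "\<not> r' < r"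
            then have "T r j \<le> T r' j"
              using SSYT_col[OF T, of r r' j] rc by (cases "r = r'") auto
            then show False
              using x rc by simp
          qed
          then have "T r' j = r' + 1"
            using less.IH[of r'] rc by simp
          then show False
            using rc x \<open>r' < r\<close> by simp
        qed
      qed
    qed
    then have "T r c = r + 1" if "j \<le> c" "c < lam r" for r c
      using right that by (cases "c = j") auto
    then show ?case
      unfolding j_def by blast
  qed
  show "c < lam r \<Longrightarrow> T r c = r + 1"
    using main[of "lam 0"] by simp
qed

definition superstandard :: "(nat \<Rightarrow> nat) \<Rightarrow> nat \<Rightarrow> nat \<Rightarrow> nat" where
  "superstandard lam r c = (if c < lam r then r + 1 else 0)"

lemma superstandard_SSYT: "lam \<in> partitions \<Longrightarrow> superstandard lam \<in> SSYT lam"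
  by (rule SSYTI) (auto simp: superstandard_def dest: partitions_antimono[of lam _ "Suc _", OF _ le_SucI[OF order_refl]])

lemma tail_count_superstandard: "tail_count lam (superstandard lam) j (Suc i) = lam i - j"
proof -
  have "{x \<in> cells lam. j \<le> snd x \<and> superstandard lam (fst x) (snd x) = Suc i} = {i} \<times> {j..<lam i}"
    by (auto simp: cells_def superstandard_def split: if_splits)
  then show ?thesis
    by (simp add: tail_count_def)
qed

lemma good_superstandard:
  assumes "lam \<in> partitions"
  shows "good (\<lambda>_. 0) lam (superstandard lam)"
  unfolding good_def
proof (intro allI impI)
  fix j i :: nat assume "1 \<le> i"
  then obtain i' where i: "i = Suc i'"
    by (cases i) auto
  show "0 + tail_count lam (superstandard lam) j (i + 1) \<le> 0 + tail_count lam (superstandard lam) j i"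
    using partitions_antimono[OF assms, of i' i]
    unfolding i Suc_eq_plus1[symmetric] tail_count_superstandard by simp
qed

lemma zero_partition: "(\<lambda>_. 0) \<in> partitions"
  by (rule partitionsI) auto

text \<open>The product rule for \<delta> = 0, where the superstandard tableau is the only survivor.
  The condition \<open>lam n = 0\<close> ensures that its letters are at most n.\<close>

lemma bialternant:
  assumes lam: "lam \<in> partitions" and n: "lam n = 0"
  shows "alternant n (shifted n (\<lambda>_. 0)) * schur n lam = alternant n (shifted n lam)"
proof -
  let ?T = "superstandard lam"
  have row: "r < n" if "c < lam r" for r c
    using that n partitions_antimono[OF lam, of n r] by (cases "r < n") auto
  have "?T \<in> SSYT_le n lam"
    by (rule SSYT_leI[OF superstandard_SSYT[OF lam]]) (auto simp: superstandard_def dest: row)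
  moreover have "T = ?T" if "T \<in> SSYT_le n lam" "good (\<lambda>_. 0) lam T" for T
    using good_zero_entries[OF lam SSYT_leD[OF that(1)] that(2)] SSYT_out[OF SSYT_leD[OF that(1)]]
    by (intro ext) (simp add: superstandard_def)
  ultimately have "{T. T \<in> SSYT_le n lam \<and> good (\<lambda>_. 0) lam T} = {?T}"
    using good_superstandard[OF lam] by blast
  moreover have "add_content (\<lambda>_. 0) lam ?T = lam"
    by (rule ext) (simp add: add_content_def letter_count_eq_tail_count tail_count_superstandard)
  ultimately show ?thesis
    unfolding alternant_mult_schur_good[OF lam zero_partition] by simp
qed

lemma lookup_alternant_shifted:
  assumes "\<nu> \<in> partitions" "\<kappa> \<in> partitions"
  shows "Poly_Mapping.lookup (alternant n (shifted n \<nu>)) (Abs_poly_mapping (shifted n \<kappa>)) =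
    (if shifted n \<nu> = shifted n \<kappa> then 1 else 0)"
  by (rule lookup_alternant) (use shifted_decreasing assms finite_shifted in blast)+

lemma alternant_rho_nonzero: "alternant n (shifted n (\<lambda>_. 0)) \<noteq> 0"
  using lookup_alternant_shifted[OF zero_partition zero_partition, of n] by auto

text \<open>\<open>shifted n\<close> sees only the rows before n, so both partitions must vanish
  from row n on.\<close>

lemma shifted_inject:
  assumes "\<nu> \<in> partitions" "\<kappa> \<in> partitions" "\<nu> n = 0" "\<kappa> n = 0"
  shows "shifted n \<nu> = shifted n \<kappa> \<longleftrightarrow> \<nu> = \<kappa>"
proof
  assume eq: "shifted n \<nu> = shifted n \<kappa>"
  show "\<nu> = \<kappa>"
  proof
    fix j
    show "\<nu> j = \<kappa> j"
    proof (cases "j < n")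
      case True
      then show ?thesis
        using fun_cong[OF eq, of "Suc j"] by (simp add: shifted_def)
    next
      case False
      then show ?thesis
        using assms partitions_antimono[of \<nu> n j] partitions_antimono[of \<kappa> n j] by simp
    qed
  qed
qed simp

section \<open>Partitions reached by Littlewood-Richardson tableaux, and finiteness\<close>

lemma add_content_partition:
  assumes lam: "lam \<in> partitions" and dl: "\<delta> \<in> partitions" and "good \<delta> lam T"
  shows "add_content \<delta> lam T \<in> partitions"
proof -
  obtain R where R: "\<And>r. R \<le> r \<Longrightarrow> \<delta> r = 0"
    using partitions_eventually_0[OF dl] by blast
  have fin: "finite ((\<lambda>x. T (fst x) (snd x)) ` cells lam)"
    using finite_cells[OF lam] by simp
  then obtain M where M: "\<And>x. x \<in> cells lam \<Longrightarrow> T (fst x) (snd x) < M"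
    unfolding finite_nat_iff_bounded by blast
  show ?thesis
  proof (rule partitionsI[where R = "R + M"])
    fix j
    show "add_content \<delta> lam T (Suc j) \<le> add_content \<delta> lam T j"
      using assms(3)[unfolded good_def, rule_format, of "j + 1" 0]
      by (simp add: add_content_def letter_count_eq_tail_count)
    assume j: "R + M \<le> j"
    have "letter_count lam T (j + 1) = 0"
    proof (rule ccontr)
      assume "letter_count lam T (j + 1) \<noteq> 0"
      then obtain r c where "c < lam r" "T r c = j + 1"
        using letter_count_pos_iff[OF lam] by blast
      then show False
        using M[of "(r, c)"] j by (simp add: cells_def)
    qed
    then show "add_content \<delta> lam T j = 0"
      using R j by (simp add: add_content_def)
  qed
qed

text \<open>A letter x > n would make row x - 1 of the resulting partition nonzero, hence also row
  n.\<close>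

lemma add_content_entry_bound:
  assumes lam: "lam \<in> partitions" and dl: "\<delta> \<in> partitions" and T: "T \<in> SSYT lam" and gd: "good \<delta> lam T"
    and n: "add_content \<delta> lam T n = 0"
  shows "T \<in> SSYT_le n lam"
proof (rule SSYT_leI[OF T])
  fix r c assume c: "c < lam r"
  show "T r c \<le> n"
  proof (rule ccontr)
    assume "\<not> T r c \<le> n"
    then have "n \<le> T r c - 1" "1 \<le> T r c"
      by simp_all
    moreover from this have "add_content \<delta> lam T (T r c - 1) \<noteq> 0"
      using letter_count_pos_iff[OF lam, of T "T r c"] c by (auto simp: add_content_def)
    ultimately show False
      using n partitions_antimono[OF add_content_partition[OF lam dl gd], of n "T r c - 1"] by simp
  qed
qed

lemma letter_count_sum:
  assumes lam: "lam \<in> partitions" and T: "T \<in> SSYT lam"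
  shows "finite {i. letter_count lam T i \<noteq> 0}" "(\<Sum>i | letter_count lam T i \<noteq> 0. letter_count lam T i) = card (cells lam)"
proof -
  let ?t = "\<lambda>x. T (fst x) (snd x)"
  have fin: "finite (cells lam)"
    by (rule finite_cells[OF lam])
  have eq: "{i. letter_count lam T i \<noteq> 0} = ?t ` cells lam"
    unfolding letter_count_pos_iff[OF lam] by (force simp: cells_def)
  show "finite {i. letter_count lam T i \<noteq> 0}"
    unfolding eq using fin by simp
  have "card (cells lam) = (\<Sum>i\<in>?t ` cells lam. card {x \<in> cells lam. ?t x = i})"
    using card_eq_sum sum.image_gen[OF fin, of "\<lambda>_. 1::nat" ?t] by simp
  then have "card (cells lam) = (\<Sum>i\<in>?t ` cells lam. letter_count lam T i)"
    unfolding letter_count_def .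
  then show "(\<Sum>i | letter_count lam T i \<noteq> 0. letter_count lam T i) = card (cells lam)"
    by (simp only: eq)
qed

lemma partition_vanishes_beyond_sum:
  assumes p: "\<nu> \<in> partitions" and "\<nu> n \<noteq> 0" "finite A" "{..n} \<subseteq> A"
  shows "n < (\<Sum>j\<in>A. \<nu> j)"
proof -
  have "n < (\<Sum>j\<le>n. 1)"
    by simp
  also have "(\<Sum>j\<le>n. 1) \<le> (\<Sum>j\<le>n. \<nu> j)"
    using assms(2) partitions_antimono[OF p, of _ n] by (intro sum_mono) (simp add: Suc_le_eq, metis less_le_trans)
  also have "\<dots> \<le> (\<Sum>j\<in>A. \<nu> j)"
    using assms(3,4) by (intro sum_mono2) auto
  finally show ?thesis .
qed

definition LR_tableaux :: "(nat \<Rightarrow> nat) \<Rightarrow> (nat \<Rightarrow> nat) \<Rightarrow> (nat \<Rightarrow> nat \<Rightarrow> nat) set" where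
  "LR_tableaux lam \<delta> = {T \<in> SSYT lam. good \<delta> lam T}"

lemma finite_LR_tableaux:
  assumes lam: "lam \<in> partitions" and dl: "\<delta> \<in> partitions"
  shows "finite (LR_tableaux lam \<delta>)"
proof -
  obtain R where R: "\<And>r. R \<le> r \<Longrightarrow> \<delta> r = 0"
    using partitions_eventually_0[OF dl] by blast
  \<comment> \<open>N is at least the size of the resulting partition, which is that of \<delta>
    plus that of \<open>lam\<close>, so row N of it is empty. The summand R places all nonzero rows
    of \<delta> before N.\<close>
  define N where "N = R + (card (cells lam) + (\<Sum>j<R. \<delta> j))"
  have "T \<in> SSYT_le N lam" if T: "T \<in> SSYT lam" and gd: "good \<delta> lam T" for T
  proof (rule add_content_entry_bound[OF lam dl T gd], rule ccontr)
    let ?\<nu> = "add_content \<delta> lam T"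
    assume "?\<nu> N \<noteq> 0"
    then have "N < (\<Sum>j\<le>N. ?\<nu> j)"
      by (intro partition_vanishes_beyond_sum add_content_partition lam dl gd) auto
    also have "(\<Sum>j\<le>N. ?\<nu> j) = (\<Sum>j\<le>N. \<delta> j) + (\<Sum>j\<le>N. letter_count lam T (Suc j))"
      by (simp add: add_content_def sum.distrib)
    also have "(\<Sum>j\<le>N. \<delta> j) = (\<Sum>j<R. \<delta> j)"
      using R by (intro sum.mono_neutral_right) (auto simp: N_def not_less[symmetric])
    also have "(\<Sum>j\<le>N. letter_count lam T (Suc j)) = (\<Sum>j\<in>Suc ` {..N}. letter_count lam T j)"
      by (simp add: sum.reindex)
    also have "\<dots> \<le> (\<Sum>j\<in>Suc ` {..N} \<union> {i. letter_count lam T i \<noteq> 0}. letter_count lam T j)"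
      using letter_count_sum(1)[OF lam T] by (intro sum_mono2) auto
    also have "\<dots> = (\<Sum>i | letter_count lam T i \<noteq> 0. letter_count lam T i)"
      using letter_count_sum(1)[OF lam T] by (intro sum.mono_neutral_right) auto
    also have "\<dots> = card (cells lam)"
      by (rule letter_count_sum(2)[OF lam T])
    finally show False
      by (simp add: N_def)
  qed
  then have "LR_tableaux lam \<delta> \<subseteq> SSYT_le N lam"
    by (auto simp: LR_tableaux_def)
  then show ?thesis
    using finite_SSYT_le[OF lam] finite_subset by blast
qed

text \<open>Both sides are multiplied by the nonzero alternant of the staircase, which is cancelled
  at the end. Tableaux with a letter above n enter for free, because their partition has more than n
  rows and its Schur polynomial is zero. If \<delta> has more than n rows, both sides
  vanish.\<close>

lemma schur_mult_schur:
  assumes lam: "lam \<in> partitions" and dl: "\<delta> \<in> partitions"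
  shows "schur n lam * schur n \<delta> = (\<Sum>T\<in>LR_tableaux lam \<delta>. schur n (add_content \<delta> lam T))"
proof (cases "\<delta> n = 0")
  case False
  then have "add_content \<delta> lam T n \<noteq> 0" for T
    by (simp add: add_content_def)
  then show ?thesis
    using schur_eq_0[OF dl False] add_content_partition[OF lam dl]
    by (auto intro!: sum.neutral schur_eq_0 simp: LR_tableaux_def)
next
  case True
  let ?\<rho> = "alternant n (shifted n (\<lambda>_. 0))"
  have "?\<rho> * (schur n lam * schur n \<delta>) = alternant n (shifted n \<delta>) * schur n lam"
    using bialternant[OF dl True] by (simp add: ac_simps)
  also have "\<dots> = (\<Sum>T | T \<in> SSYT_le n lam \<and> good \<delta> lam T. alternant n (shifted n (add_content \<delta> lam T)))"
    by (rule alternant_mult_schur_good[OF lam dl])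
  also have "\<dots> = (\<Sum>T | T \<in> SSYT_le n lam \<and> good \<delta> lam T. ?\<rho> * schur n (add_content \<delta> lam T))"
  proof (rule sum.cong[OF refl])
    fix T assume "T \<in> {T. T \<in> SSYT_le n lam \<and> good \<delta> lam T}"
    then have T: "T \<in> SSYT_le n lam" "good \<delta> lam T"
      by auto
    have "letter_count lam T (n + 1) = 0"
      using letter_count_support[OF lam T(1)] by auto
    then have "add_content \<delta> lam T n = 0"
      using True by (simp add: add_content_def)
    then show "alternant n (shifted n (add_content \<delta> lam T)) = ?\<rho> * schur n (add_content \<delta> lam T)"
      using bialternant[OF add_content_partition[OF lam dl T(2)]] by simp
  qed
  also have "\<dots> = (\<Sum>T\<in>LR_tableaux lam \<delta>. ?\<rho> * schur n (add_content \<delta> lam T))"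
  proof (rule sum.mono_neutral_left)
    show "finite (LR_tableaux lam \<delta>)"
      by (rule finite_LR_tableaux[OF lam dl])
    show "{T. T \<in> SSYT_le n lam \<and> good \<delta> lam T} \<subseteq> LR_tableaux lam \<delta>"
      by (auto simp: LR_tableaux_def SSYT_leD)
    show "\<forall>T\<in>LR_tableaux lam \<delta> - {T. T \<in> SSYT_le n lam \<and> good \<delta> lam T}. ?\<rho> * schur n (add_content \<delta> lam T) = 0"
    proof
      fix T assume "T \<in> LR_tableaux lam \<delta> - {T. T \<in> SSYT_le n lam \<and> good \<delta> lam T}"
      then have T: "T \<in> SSYT lam" "good \<delta> lam T" "T \<notin> SSYT_le n lam"
        by (auto simp: LR_tableaux_def)
      then have "add_content \<delta> lam T n \<noteq> 0"
        using add_content_entry_bound[OF lam dl T(1,2)] by blast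
      then show "?\<rho> * schur n (add_content \<delta> lam T) = 0"
        using schur_eq_0[OF add_content_partition[OF lam dl T(2)]] by simp
    qed
  qed
  also have "\<dots> = ?\<rho> * (\<Sum>T\<in>LR_tableaux lam \<delta>. schur n (add_content \<delta> lam T))"
    by (rule sum_distrib_left[symmetric])
  finally show ?thesis
    using alternant_rho_nonzero by simp
qed

text \<open>n is chosen so large that every partition in either support has at most n rows. After
  multiplication by the staircase alternant, d \<kappa> is the coefficient at the exponent
  \<open>shifted n \<kappa>\<close>.\<close>

lemma schur_expansion_unique:
  assumes c: "finite {\<nu>. c \<nu> \<noteq> 0}" "{\<nu>. c \<nu> \<noteq> 0} \<subseteq> partitions"
    and c': "finite {\<nu>. c' \<nu> \<noteq> 0}" "{\<nu>. c' \<nu> \<noteq> 0} \<subseteq> partitions"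
    and eq: "\<And>n. (\<Sum>\<nu> | c \<nu> \<noteq> 0. of_int (c \<nu>) * schur n \<nu>) = (\<Sum>\<nu> | c' \<nu> \<noteq> 0. of_int (c' \<nu>) * schur n \<nu>)"
  shows "c = (c' :: (nat \<Rightarrow> nat) \<Rightarrow> int)"
proof -
  define S where "S = {\<nu>. c \<nu> \<noteq> 0} \<union> {\<nu>. c' \<nu> \<noteq> 0}"
  have fin: "finite S" and part: "S \<subseteq> partitions"
    using c c' by (auto simp: S_def)
  have "\<exists>R. \<forall>r\<ge>R. \<nu> r = 0" if "\<nu> \<in> S" for \<nu>
    using partitions_eventually_0[of \<nu>] that part by blast
  then obtain R where R: "\<And>\<nu> r. \<nu> \<in> S \<Longrightarrow> R \<nu> \<le> r \<Longrightarrow> \<nu> r = 0"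
    by metis
  define n where "n = Max (insert 0 (R ` S))"
  have n: "\<nu> n = 0" if "\<nu> \<in> S" for \<nu>
    using R[OF that, of n] fin that by (simp add: n_def)
  let ?\<rho> = "alternant n (shifted n (\<lambda>_. 0))"
  have coeff: "d \<kappa> = Poly_Mapping.lookup (?\<rho> * (\<Sum>\<nu> | d \<nu> \<noteq> 0. of_int (d \<nu>) * schur n \<nu>)) (Abs_poly_mapping (shifted n \<kappa>))"
    if d: "{\<nu>. d \<nu> \<noteq> 0} \<subseteq> S" and \<kappa>: "\<kappa> \<in> S" for d :: "(nat \<Rightarrow> nat) \<Rightarrow> int" and \<kappa>
  proof -
    have "?\<rho> * (\<Sum>\<nu> | d \<nu> \<noteq> 0. of_int (d \<nu>) * schur n \<nu>) = ?\<rho> * (\<Sum>\<nu>\<in>S. of_int (d \<nu>) * schur n \<nu>)"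
      by (intro arg_cong2[where f = "(*)"] refl sum.mono_neutral_left fin d) auto
    also have "\<dots> = (\<Sum>\<nu>\<in>S. of_int (d \<nu>) * alternant n (shifted n \<nu>))"
      unfolding sum_distrib_left
      by (rule sum.cong[OF refl]) (use bialternant n part in \<open>auto simp: mult.left_commute subset_iff\<close>)
    finally have "Poly_Mapping.lookup (?\<rho> * (\<Sum>\<nu> | d \<nu> \<noteq> 0. of_int (d \<nu>) * schur n \<nu>)) (Abs_poly_mapping (shifted n \<kappa>))
      = (\<Sum>\<nu>\<in>S. Poly_Mapping.lookup (of_int (d \<nu>) * alternant n (shifted n \<nu>)) (Abs_poly_mapping (shifted n \<kappa>)))"
      by (simp add: lookup_sum)
    also have "\<dots> = (\<Sum>\<nu>\<in>S. if \<nu> = \<kappa> then d \<nu> else 0)"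
    proof (rule sum.cong[OF refl])
      fix \<nu> assume \<nu>: "\<nu> \<in> S"
      have of_int_mult: "Poly_Mapping.lookup (of_int z * p) k = z * Poly_Mapping.lookup p k" for z :: int and p :: "(nat \<Rightarrow>\<^sub>0 nat) \<Rightarrow>\<^sub>0 int" and k
        by (induction z rule: int_induct[where k = 0]) (simp_all add: lookup_add lookup_minus algebra_simps)
      show "Poly_Mapping.lookup (of_int (d \<nu>) * alternant n (shifted n \<nu>)) (Abs_poly_mapping (shifted n \<kappa>)) = (if \<nu> = \<kappa> then d \<nu> else 0)"
        unfolding of_int_mult using \<nu> \<kappa> part n lookup_alternant_shifted[of \<nu> \<kappa> n] shifted_inject[of \<nu> \<kappa> n]
        by (simp add: subset_iff)
    qed
    also have "\<dots> = d \<kappa>"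
      using fin \<kappa> by simp
    finally show ?thesis ..
  qed
  show ?thesis
  proof
    fix \<kappa>
    show "c \<kappa> = c' \<kappa>"
    proof (cases "\<kappa> \<in> S")
      case True
      have "{\<nu>. c \<nu> \<noteq> 0} \<subseteq> S" "{\<nu>. c' \<nu> \<noteq> 0} \<subseteq> S"
        by (auto simp: S_def)
      then show ?thesis
        using coeff[OF _ True, of c] coeff[OF _ True, of c'] eq[of n] by simp
    next
      case False
      then show ?thesis
        by (auto simp: S_def)
    qed
  qed
qed

lemma LR_rule:
  assumes lam: "lam \<in> partitions" and dl: "\<delta> \<in> partitions"
  shows "LR lam \<delta> \<nu> = int (card {T \<in> LR_tableaux lam \<delta>. add_content \<delta> lam T = \<nu>})"
proof -
  let ?L = "LR_tableaux lam \<delta>"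
  define c where "c \<nu> = int (card {T \<in> ?L. add_content \<delta> lam T = \<nu>})" for \<nu>
  have fin: "finite ?L"
    by (rule finite_LR_tableaux[OF lam dl])
  have supp: "{\<nu>. c \<nu> \<noteq> 0} = add_content \<delta> lam ` ?L"
    using fin by (auto simp: c_def card_eq_0_iff)
  have c1: "finite {\<nu>. c \<nu> \<noteq> 0}"
    unfolding supp using fin by simp
  have c2: "{\<nu>. c \<nu> \<noteq> 0} \<subseteq> partitions"
    unfolding supp using add_content_partition[OF lam dl] by (auto simp: LR_tableaux_def)
  have c3: "schur n lam * schur n \<delta> = (\<Sum>\<nu> | c \<nu> \<noteq> 0. of_int (c \<nu>) * schur n \<nu>)" for n
  proof -
    have "schur n lam * schur n \<delta> =
        (\<Sum>\<nu>\<in>add_content \<delta> lam ` ?L. \<Sum>T | T \<in> ?L \<and> add_content \<delta> lam T = \<nu>. schur n (add_content \<delta> lam T))"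
      unfolding schur_mult_schur[OF lam dl] by (rule sum.image_gen[OF fin])
    also have "\<dots> = (\<Sum>\<nu>\<in>add_content \<delta> lam ` ?L. of_int (c \<nu>) * schur n \<nu>)"
      by (rule sum.cong[OF refl]) (simp add: c_def)
    finally show ?thesis
      unfolding supp .
  qed
  have "LR lam \<delta> = c"
    unfolding LR_def
  proof (rule the_equality)
    show "finite {\<nu>. c \<nu> \<noteq> 0} \<and> {\<nu>. c \<nu> \<noteq> 0} \<subseteq> partitions \<and>
      (\<forall>n. schur n lam * schur n \<delta> = (\<Sum>\<nu> | c \<nu> \<noteq> 0. of_int (c \<nu>) * schur n \<nu>))"
      using c1 c2 c3 by blast
  next
    fix c'
    assume c': "finite {\<nu>. c' \<nu> \<noteq> 0} \<and> {\<nu>. c' \<nu> \<noteq> 0} \<subseteq> partitions \<and>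
      (\<forall>n. schur n lam * schur n \<delta> = (\<Sum>\<nu> | c' \<nu> \<noteq> 0. of_int (c' \<nu>) * schur n \<nu>))"
    show "c' = c"
      by (rule schur_expansion_unique) (use c' c1 c2 c3 in auto)
  qed
  then show ?thesis
    by (simp add: c_def)
qed

subsection \<open>Signatures\<close>

text \<open>In every prefix of \<open>w\<close> the excess of \<open>Minus\<close> over \<open>Plus\<close> is at most \<open>d\<close>; this is invariant
  under \<open>cancel\<close>.\<close>

primrec ballot :: "nat \<Rightarrow> sgn_letter list \<Rightarrow> bool" where
  "ballot d [] = True"
| "ballot d (x # w) = (case x of Plus \<Rightarrow> ballot (d + 1) w | Minus \<Rightarrow> 0 < d \<and> ballot (d - 1) w)"

text \<open>After u the allowance has become the displayed difference. Whenever
  \<open>ballot d u\<close> holds, the subtraction is not truncated, by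
  \<open>ballot_count\<close>.\<close>

lemma ballot_append:
  "ballot d (u @ v) \<longleftrightarrow> ballot d u \<and> ballot (d + count_list u Plus - count_list u Minus) v"
proof (induction u arbitrary: d)
  case (Cons x u)
  show ?case
  proof (cases x)
    case Plus
    then show ?thesis
      using Cons[of "d + 1"] by simp
  next
    case Minus
    then show ?thesis
      using Cons[of "d - 1"] by (cases d) simp_all
  qed
qed simp

lemma ballot_count: "ballot d u \<Longrightarrow> count_list u Minus \<le> d + count_list u Plus"
proof (induction u arbitrary: d)
  case (Cons x u)
  show ?case
  proof (cases x)
    case Plus
    then show ?thesis
      using Cons(1)[of "d + 1"] Cons(2) by simp
  next
    case Minus
    then show ?thesis
      using Cons(1)[of "d - 1"] Cons(2) by (cases d) simp_all
  qed
qed simp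

lemma ballot_cancel: "cancel u v \<Longrightarrow> ballot d u \<longleftrightarrow> ballot d v"
  by (induction rule: cancel.induct) (simp add: ballot_append)

text \<open>On normal forms the least admissible d is p, so \<open>ballot\<close> recovers
  \<epsilon> without performing any cancellation.\<close>

lemma ballot_normal_form: "ballot d (replicate p Minus @ replicate q Plus) \<longleftrightarrow> p \<le> d"
proof (induction p arbitrary: d)
  case 0
  show ?case
    by (induction q arbitrary: d) auto
next
  case (Suc p)
  then show ?case by (cases d) auto
qed

lemma count_list_replicate: "count_list (replicate n x) y = (if x = y then n else 0)"
  by (induction n) auto

lemma count_cancel: "cancel u v \<Longrightarrow> count_list u Plus + count_list v Minus = count_list v Plus + count_list u Minus"
  by (induction rule: cancel.induct) simp

text \<open>Two invariants of \<open>cancel\<close>, the ballot property and the difference of the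
  two letter counts, are carried from the signature to its normal form.\<close>

lemma
  shows eps_le_iff_ballot: "eps i lam b \<le> d \<longleftrightarrow> ballot d (signature i (reading lam b))"
    and phi_eps_count: "phi i lam b + count_list (signature i (reading lam b)) Minus =
      eps i lam b + count_list (signature i (reading lam b)) Plus"
proof -
  let ?w = "signature i (reading lam b)"
  obtain p q where pq: "cancel\<^sup>*\<^sup>* ?w (replicate p Minus @ replicate q Plus)"
    and unique: "\<And>p' q'. cancel\<^sup>*\<^sup>* ?w (replicate p' Minus @ replicate q' Plus) \<Longrightarrow> p' = p \<and> q' = q"
    using cancel_unique[of ?w] by blast
  have eps: "eps i lam b = p"
    unfolding eps_def using pq unique by blast
  have phi: "phi i lam b = q"
    unfolding phi_def using pq unique by blast
  have "ballot d ?w \<longleftrightarrow> ballot d (replicate p Minus @ replicate q Plus)"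
    using pq by (induction rule: rtranclp_induct) (simp_all add: ballot_cancel)
  then show "eps i lam b \<le> d \<longleftrightarrow> ballot d ?w"
    by (simp add: eps ballot_normal_form)
  have "count_list ?w Plus + count_list v Minus = count_list v Plus + count_list ?w Minus"
    if "cancel\<^sup>*\<^sup>* ?w v" for v
    using that
  proof (induction rule: rtranclp_induct)
    case (step y z)
    then show ?case
      using count_cancel[OF step(2)] by linarith
  qed simp
  from this[OF pq] show "phi i lam b + count_list ?w Minus = eps i lam b + count_list ?w Plus"
    by (simp add: eps phi count_list_replicate)
qed

lemma signature_append: "signature i (u @ v) = signature i u @ signature i v"
  by (simp add: signature_def)

text \<open>Applied to a column: its signature is a subword of \<open>[Plus, Minus]\<close>, so the
  excess of \<open>Minus\<close> need only be tested at column boundaries.\<close>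

lemma signature_strictly_increasing:
  "sorted_wrt (<) l \<Longrightarrow>
    signature i l = (if i \<in> set l then [Plus] else []) @ (if i + 1 \<in> set l then [Minus] else [])"
  by (induction l) (auto simp: signature_def)

text \<open>Lowering m appends column m to the end of the word. The counts are proved together with
  the ballot claim because \<open>ballot_append\<close> needs them for the allowance left.\<close>

lemma reading_tail:
  fixes i d :: nat
  assumes T: "T \<in> SSYT lam" and lam: "lam \<in> partitions"
  defines "w \<equiv> (\<lambda>m. signature i (concat (map (\<lambda>c. map (\<lambda>r. T r c) [0..<col_height lam c]) (rev [m..<lam 0]))))"
  assumes m: "m \<le> lam 0"
  shows "count_list (w m) Plus = tail_count lam T m i \<and> count_list (w m) Minus = tail_count lam T m (i + 1) \<and>
    (ballot d (w m) \<longleftrightarrow> (\<forall>j\<ge>m. tail_count lam T j (i + 1) \<le> d + tail_count lam T j i))"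
  using m
proof (induction m rule: inc_induct)
  case base
  show ?case
    using tail_count_beyond[OF lam] by (simp add: w_def signature_def)
next
  case (step m)
  let ?col = "map (\<lambda>r. T r m) [0..<col_height lam m]"
  have "rev [m..<lam 0] = rev [Suc m..<lam 0] @ [m]"
    using step(2) by (simp add: upt_conv_Cons)
  then have w: "w m = w (Suc m) @ signature i ?col"
    by (simp add: w_def signature_append)
  have rows: "{r. m < lam r} = {..<col_height lam m}"
  proof -
    obtain R where R: "\<And>r. R \<le> r \<Longrightarrow> lam r = 0"
      using partitions_eventually_0[OF lam] by blast
    have "{r. m < lam r} \<subseteq> {..<R}"
    proof
      fix r assume "r \<in> {r. m < lam r}"
      then show "r \<in> {..<R}"
        using R[of r] by (cases "r < R") simp_all
    qed
    then have fin: "finite {r. m < lam r}"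
      by (rule finite_subset) simp
    have "{r. m < lam r} = {..<card {r. m < lam r}}"
    proof (rule down_closed_eq_lessThan_card[OF fin])
      fix x y assume "x \<in> {r. m < lam r}" "y \<le> x"
      then show "y \<in> {r. m < lam r}"
        using partitions_antimono[OF lam, of y x] by simp
    qed
    then show ?thesis
      by (simp add: col_height_def cells_def)
  qed
  then have row: "r < col_height lam m \<longleftrightarrow> m < lam r" for r
    by blast
  have sorted: "sorted_wrt (<) ?col"
    unfolding sorted_wrt_iff_nth_less
  proof (intro allI impI)
    fix r r' assume r: "r < r'" "r' < length ?col"
    then have "T r m < T r' m"
      using row by (intro SSYT_col[OF T]) auto
    then show "?col ! r < ?col ! r'"
      using r by simp
  qed
  have in_col: "x \<in> set ?col \<longleftrightarrow> (\<exists>r. m < lam r \<and> T r m = x)" for x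
    by (auto simp: row)
  let ?p = "if \<exists>r. m < lam r \<and> T r m = i then 1 else 0 :: nat"
  let ?q = "if \<exists>r. m < lam r \<and> T r m = i + 1 then 1 else 0 :: nat"
  have sig: "signature i ?col = replicate ?p Plus @ replicate ?q Minus"
    unfolding signature_strictly_increasing[OF sorted] in_col by simp
  have tails: "tail_count lam T m i = tail_count lam T (Suc m) i + ?p"
    "tail_count lam T m (i + 1) = tail_count lam T (Suc m) (i + 1) + ?q"
    by (rule tail_count_Suc[OF T lam])+
  have IH: "count_list (w (Suc m)) Plus = tail_count lam T (Suc m) i"
      "count_list (w (Suc m)) Minus = tail_count lam T (Suc m) (i + 1)"
      "ballot d (w (Suc m)) \<longleftrightarrow> (\<forall>j\<ge>Suc m. tail_count lam T j (i + 1) \<le> d + tail_count lam T j i)"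
    using step.IH by auto
  have counts: "count_list (w m) Plus = tail_count lam T m i" "count_list (w m) Minus = tail_count lam T m (i + 1)"
    unfolding w sig tails using IH(1,2) by (auto simp: count_list_replicate)
  have "ballot e (signature i ?col) \<longleftrightarrow> ?q \<le> e + ?p" for e
    unfolding sig by auto
  then have "ballot d (w m) \<longleftrightarrow> ballot d (w (Suc m)) \<and>
     ?q \<le> d + tail_count lam T (Suc m) i - tail_count lam T (Suc m) (i + 1) + ?p"
    unfolding w ballot_append IH(1,2) by blast
  \<comment> \<open>Under the first conjunct the natural-number subtraction is exact, so it can be
    moved to the other side.\<close>
  also have "\<dots> \<longleftrightarrow> ballot d (w (Suc m)) \<and> tail_count lam T m (i + 1) \<le> d + tail_count lam T m i"
    using ballot_count[of d "w (Suc m)"] unfolding tails IH(1,2) by auto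
  also have "\<dots> \<longleftrightarrow> (\<forall>j\<ge>m. tail_count lam T j (i + 1) \<le> d + tail_count lam T j i)"
    unfolding IH(3) by (metis Suc_le_eq le_eq_less_or_eq)
  finally show ?case
    using counts by blast
qed

lemma
  assumes "T \<in> SSYT lam" "lam \<in> partitions"
  shows eps_le_iff: "eps i lam T \<le> d \<longleftrightarrow> (\<forall>j. tail_count lam T j (i + 1) \<le> d + tail_count lam T j i)"
    and phi_eps_content: "phi i lam T + letter_count lam T (i + 1) = eps i lam T + letter_count lam T i"
  using reading_tail[OF assms le0, of i d] eps_le_iff_ballot[of i lam T d] phi_eps_count[of i lam T]
  unfolding reading_def[symmetric] letter_count_eq_tail_count by simp_all

lemma eps_le_content:
  assumes "T \<in> SSYT lam" "lam \<in> partitions"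
  shows "eps i lam T \<le> letter_count lam T (i + 1)"
  unfolding eps_le_iff[OF assms]
proof
  fix j
  show "tail_count lam T j (i + 1) \<le> letter_count lam T (i + 1) + tail_count lam T j i"
    using letter_count_split[OF assms(2), of T "i + 1" j] by simp
qed

lemma phi_le_content:
  assumes "T \<in> SSYT lam" "lam \<in> partitions"
  shows "phi i lam T \<le> letter_count lam T i"
  using phi_eps_content[OF assms, of i] eps_le_content[OF assms, of i] by simp

lemma
  assumes "T \<in> SSYT lam" "lam \<in> partitions"
  shows finite_eps: "finite {i. eps i lam T \<noteq> 0}"
    and finite_phi: "finite {i. phi i lam T \<noteq> 0}"
proof -
  note fin = letter_count_sum(1)[OF assms(2,1)]
  have "{i. phi i lam T \<noteq> 0} \<subseteq> {i. letter_count lam T i \<noteq> 0}"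
  proof
    fix i assume "i \<in> {i. phi i lam T \<noteq> 0}"
    then show "i \<in> {i. letter_count lam T i \<noteq> 0}"
      using phi_le_content[OF assms, of i] by simp
  qed
  then show "finite {i. phi i lam T \<noteq> 0}"
    using fin by (rule finite_subset)
  have "{i. eps i lam T \<noteq> 0} \<subseteq> Suc -` {i. letter_count lam T i \<noteq> 0}"
  proof
    fix i assume "i \<in> {i. eps i lam T \<noteq> 0}"
    then show "i \<in> Suc -` {i. letter_count lam T i \<noteq> 0}"
      using eps_le_content[OF assms, of i] by simp
  qed
  then show "finite {i. eps i lam T \<noteq> 0}"
    using finite_vimageI[OF fin, of Suc] by (simp add: finite_subset)
qed

text \<open>For fixed i, the conditions over all j say that \<epsilon> at i is at most \<delta> (i -
  1) - \<delta> i, the coefficient of \<delta> at \<open>omega i\<close>.\<close>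

lemma good_iff_eps:
  assumes "T \<in> SSYT lam" "lam \<in> partitions" "\<delta> \<in> partitions"
  shows "good \<delta> lam T \<longleftrightarrow> (\<forall>i\<ge>1. eps i lam T + \<delta> i \<le> \<delta> (i - 1))"
proof -
  have "(\<forall>j. \<delta> i + tail_count lam T j (i + 1) \<le> \<delta> (i - 1) + tail_count lam T j i) \<longleftrightarrow>
      eps i lam T + \<delta> i \<le> \<delta> (i - 1)" for i
  proof -
    have le: "\<delta> i \<le> \<delta> (i - 1)"
      by (rule partitions_antimono[OF assms(3)]) simp
    then have "eps i lam T + \<delta> i \<le> \<delta> (i - 1) \<longleftrightarrow> eps i lam T \<le> \<delta> (i - 1) - \<delta> i"
      by auto
    also have "\<dots> \<longleftrightarrow> (\<forall>j. \<delta> i + tail_count lam T j (i + 1) \<le> \<delta> (i - 1) + tail_count lam T j i)"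
      unfolding eps_le_iff[OF assms(1,2)] using le by (intro all_cong1) auto
    finally show ?thesis ..
  qed
  then show ?thesis
    unfolding good_def by blast
qed

subsection \<open>Coordinates with respect to the fundamental weights\<close>

text \<open>Rows j and j + 1 differ by the columns of height exactly j + 1, so coefficients can be
  read off as row differences.\<close>

lemma comb_omega_Suc:
  assumes "finite {i. a i \<noteq> 0}"
  shows "comb a omega j = a (Suc j) + comb a omega (Suc j)"
proof -
  have eq: "comb a omega j = (\<Sum>i | i \<noteq> 0 \<and> a i \<noteq> 0. if j < i then a i else 0)" for j
    unfolding comb_def omega_def by (rule sum.cong) auto
  have fin: "finite {i. i \<noteq> 0 \<and> a i \<noteq> 0}"
    by (rule finite_subset[OF _ assms]) auto
  have "comb a omega j = (\<Sum>i | i \<noteq> 0 \<and> a i \<noteq> 0. (if i = Suc j then a (Suc j) else 0) + (if Suc j < i then a i else 0))"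
    unfolding eq
  proof (rule sum.cong[OF refl])
    fix i
    show "(if j < i then a i else 0) = (if i = Suc j then a (Suc j) else 0) + (if Suc j < i then a i else 0)"
      by (cases i "Suc j" rule: linorder_cases) simp_all
  qed
  also have "\<dots> = a (Suc j) + comb a omega (Suc j)"
    unfolding sum.distrib eq using fin by simp
  finally show ?thesis .
qed

lemma comb_omega_eventually_0:
  assumes "finite {i. a i \<noteq> 0}"
  obtains R where "\<And>j. R \<le> j \<Longrightarrow> comb a omega j = 0"
proof -
  obtain R where R: "{i. a i \<noteq> 0} \<subseteq> {..<R}"
    using assms unfolding finite_nat_iff_bounded by blast
  show ?thesis
  proof (rule that)
    fix j assume "R \<le> j"
    then show "comb a omega j = 0"
      unfolding comb_def omega_def using R by (intro sum.neutral) force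
  qed
qed

lemma comb_omega_partition:
  assumes "finite {i. a i \<noteq> 0}"
  shows "comb a omega \<in> partitions"
proof -
  obtain R where R: "\<And>j. R \<le> j \<Longrightarrow> comb a omega j = 0"
    using comb_omega_eventually_0[OF assms] by blast
  show ?thesis
  proof (rule partitionsI)
    show "comb a omega (Suc j) \<le> comb a omega j" for j
      using comb_omega_Suc[OF assms, of j] by simp
  qed (rule R)
qed

lemma eqI_differences:
  fixes f g :: "nat \<Rightarrow> nat"
  assumes diff: "\<And>j. f j + g (Suc j) = g j + f (Suc j)"
    and f: "\<And>j. R \<le> j \<Longrightarrow> f j = 0" and g: "\<And>j. R' \<le> j \<Longrightarrow> g j = 0"
  shows "f = g"
proof
  fix j
  define N where "N = j + R + R'"
  have "j \<le> N"
    by (simp add: N_def)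
  then show "f j = g j"
  proof (induction rule: inc_induct)
    case base
    show ?case using f g by (simp add: N_def)
  next
    case (step n)
    then show ?case using diff[of n] by simp
  qed
qed

lemma eq_comb_omegaI:
  assumes f: "\<And>j. f j = a (Suc j) + f (Suc j)" "\<And>j. R \<le> j \<Longrightarrow> f j = 0" and a: "finite {i. a i \<noteq> 0}"
  shows "f = comb a omega"
proof -
  obtain R' where R': "\<And>j. R' \<le> j \<Longrightarrow> comb a omega j = 0"
    using comb_omega_eventually_0[OF a] by blast
  have "f j + comb a omega (Suc j) = comb a omega j + f (Suc j)" for j
    using f(1)[of j] comb_omega_Suc[OF a, of j] by simp
  then show ?thesis
    using f(2) R' by (rule eqI_differences)
qed

lemma partition_eq_comb:
  assumes p: "\<kappa> \<in> partitions"
  obtains a where "finite {i. a i \<noteq> 0}" "\<kappa> = comb a omega"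
proof -
  obtain R where R: "\<And>r. R \<le> r \<Longrightarrow> \<kappa> r = 0"
    using partitions_eventually_0[OF p] by blast
  \<comment> \<open>For i = 0 both terms are \<kappa> 0, and the value is 0.\<close>
  define a where "a i = \<kappa> (i - 1) - \<kappa> i" for i
  have "{i. a i \<noteq> 0} \<subseteq> {..R}"
  proof
    fix i assume "i \<in> {i. a i \<noteq> 0}"
    then have "\<kappa> (i - 1) \<noteq> 0"
      by (auto simp: a_def)
    then have "\<not> R \<le> i - 1"
      using R by metis
    then show "i \<in> {..R}"
      by simp
  qed
  then have fin: "finite {i. a i \<noteq> 0}"
    by (rule finite_subset) simp
  have "\<kappa> j = a (Suc j) + \<kappa> (Suc j)" for j
    using partitions_antimono[OF p, of j "Suc j"] by (simp add: a_def)
  then have "\<kappa> = comb a omega"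
    using R fin by (rule eq_comb_omegaI)
  with fin show ?thesis
    by (rule that)
qed

lemma comb_omega_eq_iff:
  assumes a: "finite {i. a i \<noteq> 0}" and b: "finite {i. b i \<noteq> 0}"
  shows "comb a omega = comb b omega \<longleftrightarrow> (\<forall>i\<ge>1. a i = b i)"
proof
  assume eq: "comb a omega = comb b omega"
  have "a (Suc j) = b (Suc j)" for j
    using comb_omega_Suc[OF a, of j] comb_omega_Suc[OF b, of j] eq by simp
  then show "\<forall>i\<ge>1. a i = b i"
    by (metis Suc_pred' le_eq_less_or_eq less_one not_less_zero order_less_le_trans)
next
  assume "\<forall>i\<ge>1. a i = b i"
  then show "comb a omega = comb b omega"
    unfolding comb_def by (intro ext sum.cong) auto
qed

lemma comb_omega_add:
  assumes a: "finite {i. a i \<noteq> 0}" and b: "finite {i. b i \<noteq> 0}"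
  shows "comb (\<lambda>i. a i + b i) omega j = comb a omega j + comb b omega j"
proof -
  obtain R R' where R: "\<And>j. R \<le> j \<Longrightarrow> comb a omega j = 0" and R': "\<And>j. R' \<le> j \<Longrightarrow> comb b omega j = 0"
    using comb_omega_eventually_0[OF a] comb_omega_eventually_0[OF b] by metis
  have "{i. a i + b i \<noteq> 0} = {i. a i \<noteq> 0} \<union> {i. b i \<noteq> 0}"
    by auto
  then have fin: "finite {i. a i + b i \<noteq> 0}"
    using a b by simp
  have "(\<lambda>j. comb a omega j + comb b omega j) = comb (\<lambda>i. a i + b i) omega"
  proof (rule eq_comb_omegaI[where R = "R + R'", OF _ _ fin])
    fix j
    show "comb a omega j + comb b omega j = a (Suc j) + b (Suc j) + (comb a omega (Suc j) + comb b omega (Suc j))"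
      using comb_omega_Suc[OF a, of j] comb_omega_Suc[OF b, of j] by simp
    show "R + R' \<le> j \<Longrightarrow> comb a omega j + comb b omega j = 0"
      using R[of j] R'[of j] by simp
  qed
  from fun_cong[OF this, of j] show ?thesis
    by simp
qed

lemma comb_omega_P_two_iff:
  assumes a: "finite {i. a i \<noteq> 0}"
  shows "comb a omega \<in> P_two \<longleftrightarrow> (\<forall>i\<ge>1. even (a i))"
proof
  assume "comb a omega \<in> P_two"
  then obtain b where b: "finite {i. b i \<noteq> 0}" "comb a omega = comb (\<lambda>i. 2 * b i) omega"
    unfolding P_two_def by blast
  from b(1) have "finite {i. 2 * b i \<noteq> 0}"
    by simp
  from comb_omega_eq_iff[OF a this] b(2) have "\<forall>i\<ge>1. a i = 2 * b i"
    by (rule iffD1)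
  then show "\<forall>i\<ge>1. even (a i)"
    by simp
next
  assume even: "\<forall>i\<ge>1. even (a i)"
  have "{i. a i div 2 \<noteq> 0} \<subseteq> {i. a i \<noteq> 0}"
    by auto
  then have fin: "finite {i. a i div 2 \<noteq> 0}"
    using a by (rule finite_subset)
  then have "finite {i. 2 * (a i div 2) \<noteq> 0}"
    by simp
  then have "comb a omega = comb (\<lambda>i. 2 * (a i div 2)) omega"
    using comb_omega_eq_iff[OF a] even by auto
  then show "comb a omega \<in> P_two"
    unfolding P_two_def using fin by (intro CollectI exI[of _ "\<lambda>i. a i div 2"] conjI)
qed

lemma comb_omega_double: "comb a (\<lambda>i. omega (2 * i)) j = comb a omega (j div 2)"
  unfolding comb_def omega_def by (rule sum.cong) auto

text \<open>Columns of even height mean that rows 2k and 2k + 1 agree, and their difference is the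
  coefficient at 2k + 1.\<close>

lemma comb_omega_P_oneone_iff:
  assumes a: "finite {i. a i \<noteq> 0}"
  shows "comb a omega \<in> P_oneone \<longleftrightarrow> (\<forall>i. odd i \<longrightarrow> a i = 0)"
proof
  assume "comb a omega \<in> P_oneone"
  then obtain b where b: "comb a omega = comb b (\<lambda>i. omega (2 * i))"
    unfolding P_oneone_def by blast
  have "comb a omega (2 * k) = comb a omega (Suc (2 * k))" for k
    unfolding b comb_omega_double by simp
  then have "a (Suc (2 * k)) = 0" for k
    using comb_omega_Suc[OF a, of "2 * k"] by simp
  then show "\<forall>i. odd i \<longrightarrow> a i = 0"
    by (metis oddE Suc_eq_plus1)
next
  assume odd: "\<forall>i. odd i \<longrightarrow> a i = 0"
  define b where "b i = a (2 * i)" for i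
  have "{i. b i \<noteq> 0} = (\<lambda>i. 2 * i) -` {i. a i \<noteq> 0}"
    by (auto simp: b_def)
  then have fin: "finite {i. b i \<noteq> 0}"
    using finite_vimageI[OF a, of "\<lambda>i. 2 * i"] by (simp add: inj_on_def)
  obtain R where R: "\<And>j. R \<le> j \<Longrightarrow> comb b omega j = 0"
    using comb_omega_eventually_0[OF fin] by blast
  have "comb b (\<lambda>i. omega (2 * i)) = comb a omega"
  proof (rule eq_comb_omegaI[where R = "2 * R", OF _ _ a])
    fix j
    show "comb b (\<lambda>i. omega (2 * i)) j = a (Suc j) + comb b (\<lambda>i. omega (2 * i)) (Suc j)"
    proof (cases "even j")
      case True
      then show ?thesis
        using odd by (simp add: comb_omega_double)
    next
      case False
      then obtain k where "j = 2 * k + 1"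
        by (rule oddE)
      then show ?thesis
        using comb_omega_Suc[OF fin, of k] b_def[of "Suc k"] by (simp add: comb_omega_double)
    qed
    show "comb b (\<lambda>i. omega (2 * i)) j = 0" if "2 * R \<le> j"
      unfolding comb_omega_double using that by (intro R) simp
  qed
  then show "comb a omega \<in> P_oneone"
    unfolding P_oneone_def using fin by force
qed

lemma P_two_partition: "\<kappa> \<in> P_two \<Longrightarrow> \<kappa> \<in> partitions"
  unfolding P_two_def by (auto intro: comb_omega_partition)

lemma P_oneone_partition:
  assumes "\<kappa> \<in> P_oneone"
  shows "\<kappa> \<in> partitions"
proof -
  obtain a where a: "finite {i. a i \<noteq> 0}" "\<kappa> = comb a (\<lambda>i. omega (2 * i))"
    using assms unfolding P_oneone_def by blast
  then have \<kappa>: "\<kappa> = (\<lambda>j. comb a omega (j div 2))"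
    by (auto simp: comb_omega_double)
  note p = comb_omega_partition[OF a(1)]
  obtain R where R: "\<And>j. R \<le> j \<Longrightarrow> comb a omega j = 0"
    using comb_omega_eventually_0[OF a(1)] by blast
  show ?thesis
    unfolding \<kappa> by (rule partitionsI[where R = "2 * R"])
      (auto intro!: partitions_antimono[OF p] R div_le_mono)
qed

lemma P_two_even:
  assumes "\<kappa> \<in> P_two"
  shows "even (\<kappa> j)"
  using assms unfolding P_two_def comb_def by (auto intro!: dvd_sum)

text \<open>The description by rows is the one suited to adding and removing columns when members
  are counted.\<close>

lemma P_box_iff:
  "\<kappa> \<in> P_box \<longleftrightarrow> \<kappa> \<in> partitions \<and> (\<forall>j. even (\<kappa> j)) \<and> (\<forall>j. \<kappa> (2 * j) = \<kappa> (2 * j + 1))"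
proof
  assume \<kappa>: "\<kappa> \<in> P_box"
  then have "\<kappa> \<in> P_two" "\<kappa> \<in> P_oneone"
    by (auto simp: P_box_def)
  moreover from this(2) have "\<kappa> (2 * j) = \<kappa> (2 * j + 1)" for j
    unfolding P_oneone_def by (auto simp: comb_omega_double)
  ultimately show "\<kappa> \<in> partitions \<and> (\<forall>j. even (\<kappa> j)) \<and> (\<forall>j. \<kappa> (2 * j) = \<kappa> (2 * j + 1))"
    using P_two_partition P_two_even by blast
next
  assume \<kappa>: "\<kappa> \<in> partitions \<and> (\<forall>j. even (\<kappa> j)) \<and> (\<forall>j. \<kappa> (2 * j) = \<kappa> (2 * j + 1))"
  then obtain a where a: "finite {i. a i \<noteq> 0}" "\<kappa> = comb a omega"
    using partition_eq_comb by blast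
  have step: "\<kappa> j = a (Suc j) + \<kappa> (Suc j)" for j
    unfolding a(2) by (rule comb_omega_Suc[OF a(1)])
  have "even (a (Suc j))" for j
    using step[of j] \<kappa> by (metis even_add)
  then have "even (a i)" if "1 \<le> i" for i
    using that by (cases i) auto
  moreover have "a i = 0" if "odd i" for i
    using that \<kappa> step by (elim oddE) (metis Suc_eq_plus1 add_cancel_left_left)
  ultimately show "\<kappa> \<in> P_box"
    unfolding P_box_def a(2) using comb_omega_P_two_iff[OF a(1)] comb_omega_P_oneone_iff[OF a(1)] by blast
qed

text \<open>The weight identity wt = \<phi> - \<epsilon>, without subtraction. Consecutive row
  differences agree by \<open>phi_eps_content\<close>, and both sides vanish eventually.\<close>

lemma phi_vec_eq:
  assumes "T \<in> SSYT lam" "lam \<in> partitions"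
  shows "phi_vec lam T j = eps_vec lam T j + letter_count lam T (Suc j)"
proof -
  note phi = finite_phi[OF assms] and eps = finite_eps[OF assms]
  obtain R where R: "\<And>j. R \<le> j \<Longrightarrow> comb (\<lambda>i. phi i lam T) omega j = 0"
    using comb_omega_eventually_0[OF phi] by blast
  obtain R' where R': "\<And>j. R' \<le> j \<Longrightarrow> comb (\<lambda>i. eps i lam T) omega j = 0"
    using comb_omega_eventually_0[OF eps] by blast
  obtain R'' where R'': "{i. letter_count lam T i \<noteq> 0} \<subseteq> {..<R''}"
    using letter_count_sum(1)[OF assms(2,1)] unfolding finite_nat_iff_bounded by blast
  have "phi_vec lam T = (\<lambda>j. eps_vec lam T j + letter_count lam T (Suc j))"
    unfolding phi_vec_def eps_vec_def
  proof (rule eqI_differences)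
    fix j
    show "comb (\<lambda>i. phi i lam T) omega j + (comb (\<lambda>i. eps i lam T) omega (Suc j) + letter_count lam T (Suc (Suc j))) =
      comb (\<lambda>i. eps i lam T) omega j + letter_count lam T (Suc j) + comb (\<lambda>i. phi i lam T) omega (Suc j)"
      using comb_omega_Suc[OF phi, of j] comb_omega_Suc[OF eps, of j] phi_eps_content[OF assms, of "Suc j"] by simp
    show "R \<le> j \<Longrightarrow> comb (\<lambda>i. phi i lam T) omega j = 0"
      by (rule R)
    show "comb (\<lambda>i. eps i lam T) omega j + letter_count lam T (Suc j) = 0" if "R' + R'' \<le> j"
    proof -
      have "Suc j \<notin> {..<R''}"
        using that by simp
      then have "letter_count lam T (Suc j) = 0"
        using R'' by blast
      then show ?thesis
        using R' that by simp
    qed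
  qed
  then show ?thesis
    by simp
qed

subsection \<open>Distinguished tableaux\<close>

definition mu_res :: "(nat \<Rightarrow> nat) \<Rightarrow> (nat \<Rightarrow> nat \<Rightarrow> nat) \<Rightarrow> nat \<Rightarrow> nat" where
  "mu_res lam b = comb (\<lambda>i. if even i then phi i lam b mod 2 else 0) omega"

lemma distinguished_iff:
  "distinguished lam \<mu> b \<longleftrightarrow> (\<lambda>j. phi_vec lam b j + \<mu> j) \<in> P_two \<and> (\<lambda>j. eps_vec lam b j + \<mu> j) \<in> P_oneone"
proof -
  have "(\<forall>j. int (f j) = int (g j) - int (\<mu> j)) \<longleftrightarrow> g = (\<lambda>j. f j + \<mu> j)" for f g :: "nat \<Rightarrow> nat"
    unfolding fun_eq_iff by (intro iff_allI) linarith
  then show ?thesis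
    unfolding distinguished_def by auto
qed

text \<open>At odd i the coefficient of \<delta> is a sum of two natural numbers that must be zero,
  so each of them is zero.\<close>

lemma distinguished_comb_iff:
  assumes T: "T \<in> SSYT lam" "lam \<in> partitions" and m: "finite {i. m i \<noteq> 0}"
  shows "distinguished lam (comb m omega) T \<longleftrightarrow>
    (\<forall>i\<ge>1. even (phi i lam T + m i)) \<and> (\<forall>i. odd i \<longrightarrow> eps i lam T = 0 \<and> m i = 0)"
proof -
  note phi = finite_phi[OF T] and eps = finite_eps[OF T]
  have fin: "finite {i. f i + m i \<noteq> 0}" if "finite {i. f i \<noteq> 0}" for f :: "nat \<Rightarrow> nat"
  proof -
    have "{i. f i + m i \<noteq> 0} = {i. f i \<noteq> 0} \<union> {i. m i \<noteq> 0}"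
      by auto
    then show ?thesis
      using that m by simp
  qed
  show ?thesis
    unfolding distinguished_iff phi_vec_def eps_vec_def
      comb_omega_add[OF phi m, symmetric] comb_omega_add[OF eps m, symmetric]
      comb_omega_P_two_iff[OF fin[OF phi]] comb_omega_P_oneone_iff[OF fin[OF eps]] by simp
qed

lemma finite_mu_res:
  assumes "T \<in> SSYT lam" "lam \<in> partitions"
  shows "finite {i. (if even i then phi i lam T mod 2 else 0) \<noteq> 0}"
  by (rule finite_subset[OF _ finite_phi[OF assms]]) (auto split: if_splits)

lemma mu_res_partition:
  assumes "T \<in> SSYT lam" "lam \<in> partitions"
  shows "mu_res lam T \<in> partitions"
  unfolding mu_res_def by (rule comb_omega_partition[OF finite_mu_res[OF assms]])

text \<open>At odd i the coefficient of \<mu> is 0. At even i its parity is that of \<phi>, so it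
  exceeds the residue by an even number. These excesses are the coefficients of the member of
  \<open>P_box\<close>.\<close>

lemma distinguished_imp_mu_res_box:
  assumes T: "T \<in> SSYT lam" "lam \<in> partitions" and \<mu>: "\<mu> \<in> partitions" and d: "distinguished lam \<mu> T"
  shows "distinguished lam (mu_res lam T) T" and "\<exists>\<kappa>\<in>P_box. \<mu> = (\<lambda>j. mu_res lam T j + \<kappa> j)"
proof -
  define r where "r i = (if even i then phi i lam T mod 2 else 0)" for i
  have "r = (\<lambda>i. if even i then phi i lam T mod 2 else 0)"
    by (rule ext) (simp only: r_def)
  then have r: "finite {i. r i \<noteq> 0}" and mu_res: "mu_res lam T = comb r omega"
    using finite_mu_res[OF T] by (simp_all only: mu_res_def)
  obtain m where m: "finite {i. m i \<noteq> 0}" "\<mu> = comb m omega"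
    using partition_eq_comb[OF \<mu>] by blast
  have dist: "\<And>i. 1 \<le> i \<Longrightarrow> even (phi i lam T + m i)" "\<And>i. odd i \<Longrightarrow> eps i lam T = 0 \<and> m i = 0"
    using d distinguished_comb_iff[OF T m(1)] unfolding m(2) by blast+
  have r_odd: "r i = 0" if "odd i" for i
    using that by (simp add: r_def)
  have par: "even (phi i lam T + r i)" if "1 \<le> i" for i
  proof (cases "even i")
    case True
    then show ?thesis by (simp add: r_def)
  next
    case False
    then show ?thesis using dist[of i] that by (simp add: r_def)
  qed
  show "distinguished lam (mu_res lam T) T"
    unfolding mu_res distinguished_comb_iff[OF T r] using par dist(2) r_odd by blast
  have le: "r i \<le> m i" if "1 \<le> i" for i
  proof (cases "odd i \<or> even (m i)")
    case True
    then have "r i = 0"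
      using dist(1)[OF that] by (auto simp: r_def)
    then show ?thesis by simp
  next
    case False
    then have "m i \<noteq> 0" and "r i \<le> 1"
      by (auto simp: r_def intro: Nat.gr0I)
    then show ?thesis by simp
  qed
  \<comment> \<open>\<open>comb\<close> ignores index 0; setting the value to 0 there lets evenness
    hold for all i.\<close>
  define k where "k i = (if i = 0 then 0 else m i - r i)" for i
  have "{i. k i \<noteq> 0} \<subseteq> {i. m i \<noteq> 0}"
    by (auto simp: k_def)
  then have k: "finite {i. k i \<noteq> 0}"
    using m(1) by (rule finite_subset)
  have even: "even (k i)" for i
  proof (cases "i = 0")
    case False
    then have "even (m i) \<longleftrightarrow> even (r i)"
      using dist(1)[of i] par[of i] by auto
    then show ?thesis
      by (simp add: k_def)
  qed (simp add: k_def)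
  have "k i = 0" if "odd i" for i
    using dist(2)[OF that] by (simp add: k_def)
  then have "comb k omega \<in> P_box"
    unfolding P_box_def using comb_omega_P_two_iff[OF k] comb_omega_P_oneone_iff[OF k] even by blast
  moreover have "{i. r i + k i \<noteq> 0} = {i. r i \<noteq> 0} \<union> {i. k i \<noteq> 0}"
    by auto
  then have rk: "finite {i. r i + k i \<noteq> 0}"
    using r k by simp
  have "m i = r i + k i" if "1 \<le> i" for i
    using le[OF that] that by (simp add: k_def)
  then have "\<mu> = comb (\<lambda>i. r i + k i) omega"
    unfolding m(2) comb_omega_eq_iff[OF m(1) rk] by blast
  then have "\<mu> = (\<lambda>j. mu_res lam T j + comb k omega j)"
    unfolding mu_res comb_omega_add[OF r k, symmetric] .
  ultimately show "\<exists>\<kappa>\<in>P_box. \<mu> = (\<lambda>j. mu_res lam T j + \<kappa> j)"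
    by blast
qed

text \<open>\<open>mu_res\<close> lies below every \<mu> that distinguishes b, and
  \<open>le_box\<close> is antisymmetric. So it is the only minimal element and the description in
  \<open>mu_min\<close> is unique.\<close>

lemma
  assumes lam: "lam \<in> partitions" and b: "b \<in> D lam"
  shows mu_res_distinguished: "distinguished lam (mu_res lam b) b"
    and mu_min_eq: "mu_min lam b = mu_res lam b"
proof -
  have T: "b \<in> SSYT lam" and "\<exists>\<mu>\<in>partitions. distinguished lam \<mu> b"
    using b by (auto simp: D_def)
  then show d: "distinguished lam (mu_res lam b) b"
    using distinguished_imp_mu_res_box(1)[OF T lam] by blast
  note p = mu_res_partition[OF T lam]
  have box: "le_box (mu_res lam b) \<mu>" if "\<mu> \<in> partitions" "distinguished lam \<mu> b" for \<mu>
    using distinguished_imp_mu_res_box(2)[OF T lam that] unfolding le_box_def by force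
  have antisym: "\<mu> = mu_res lam b" if "\<mu> \<in> partitions" "distinguished lam \<mu> b" and le: "le_box \<mu> (mu_res lam b)" for \<mu>
  proof
    fix j
    have "le_box (mu_res lam b) \<mu>"
      by (rule box) fact+
    with le obtain \<kappa> \<kappa>' where "int (\<kappa> j) = int (\<mu> j) - int (mu_res lam b j)" "int (\<kappa>' j) = int (mu_res lam b j) - int (\<mu> j)"
      unfolding le_box_def by blast
    then show "\<mu> j = mu_res lam b j"
      by linarith
  qed
  show "mu_min lam b = mu_res lam b"
    unfolding mu_min_def
  proof (rule the_equality)
    show "mu_res lam b \<in> partitions \<and> distinguished lam (mu_res lam b) b \<and>
      (\<forall>\<mu>'\<in>partitions. distinguished lam \<mu>' b \<and> le_box \<mu>' (mu_res lam b) \<longrightarrow> \<mu>' = mu_res lam b)"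
      using p d antisym by blast
  next
    fix \<mu>
    assume "\<mu> \<in> partitions \<and> distinguished lam \<mu> b \<and>
      (\<forall>\<mu>'\<in>partitions. distinguished lam \<mu>' b \<and> le_box \<mu>' \<mu> \<longrightarrow> \<mu>' = \<mu>)"
    then show "\<mu> = mu_res lam b"
      using box p d by metis
  qed
qed

lemma P_box_add:
  "\<nu> \<in> P_two \<Longrightarrow> \<kappa> \<in> P_box \<Longrightarrow> (\<lambda>j. \<nu> j + \<kappa> j) \<in> P_two"
  "\<nu> \<in> P_oneone \<Longrightarrow> \<kappa> \<in> P_box \<Longrightarrow> (\<lambda>j. \<nu> j + \<kappa> j) \<in> P_oneone"
proof -
  have fin: "finite {i. f i + m i \<noteq> 0}" if "finite {i. f i \<noteq> 0}" "finite {i. m i \<noteq> 0}" for f m :: "nat \<Rightarrow> nat"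
  proof -
    have "{i. f i + m i \<noteq> 0} = {i. f i \<noteq> 0} \<union> {i. m i \<noteq> 0}"
      by auto
    then show ?thesis
      using that by simp
  qed
  assume \<kappa>: "\<kappa> \<in> P_box"
  then have \<kappa>': "\<kappa> \<in> P_two" "\<kappa> \<in> P_oneone"
    by (auto simp: P_box_def)
  then obtain k where k: "finite {i. k i \<noteq> 0}" "\<kappa> = comb k omega"
    using partition_eq_comb P_two_partition by blast
  show "(\<lambda>j. \<nu> j + \<kappa> j) \<in> P_two" if \<nu>: "\<nu> \<in> P_two"
  proof -
    obtain n where n: "finite {i. n i \<noteq> 0}" "\<nu> = comb n omega"
      using partition_eq_comb P_two_partition[OF \<nu>] by blast
    show ?thesis
      using \<nu> \<kappa>'(1) unfolding n(2) k(2) comb_omega_add[OF n(1) k(1), symmetric]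
        comb_omega_P_two_iff[OF n(1)] comb_omega_P_two_iff[OF k(1)] comb_omega_P_two_iff[OF fin[OF n(1) k(1)]] by simp
  qed
  show "(\<lambda>j. \<nu> j + \<kappa> j) \<in> P_oneone" if \<nu>: "\<nu> \<in> P_oneone"
  proof -
    obtain n where n: "finite {i. n i \<noteq> 0}" "\<nu> = comb n omega"
      using partition_eq_comb P_oneone_partition[OF \<nu>] by blast
    show ?thesis
      using \<nu> \<kappa>'(2) unfolding n(2) k(2) comb_omega_add[OF n(1) k(1), symmetric]
        comb_omega_P_oneone_iff[OF n(1)] comb_omega_P_oneone_iff[OF k(1)] comb_omega_P_oneone_iff[OF fin[OF n(1) k(1)]] by simp
  qed
qed

subsection \<open>The generating function of \<open>P_box\<close>\<close>

lemma psize_eq_sum: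
  assumes "finite A" "\<And>j. j \<notin> A \<Longrightarrow> f j = 0"
  shows "psize f = (\<Sum>j\<in>A. f j)"
proof -
  have "{j. f j \<noteq> 0} \<subseteq> A"
  proof
    fix j assume "j \<in> {j. f j \<noteq> 0}"
    then show "j \<in> A"
      using assms(2)[of j] by (cases "j \<in> A") simp_all
  qed
  with assms(1) show ?thesis
    unfolding psize_def by (rule sum.mono_neutral_left) simp
qed

lemma psize_add:
  assumes "f \<in> partitions" "g \<in> partitions"
  shows "psize (\<lambda>j. f j + g j) = psize f + psize g"
proof -
  let ?A = "{j. f j \<noteq> 0} \<union> {j. g j \<noteq> 0}"
  have fin: "finite ?A"
    using assms by (simp add: partitions_def)
  show ?thesis
    using psize_eq_sum[OF fin, of "\<lambda>j. f j + g j"] psize_eq_sum[OF fin, of f] psize_eq_sum[OF fin, of g]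
    by (simp add: sum.distrib)
qed

lemma psize_P_two_even:
  assumes "\<kappa> \<in> P_two"
  shows "even (psize \<kappa>)"
  unfolding psize_def by (rule dvd_sum) (rule P_two_even[OF assms])

lemma partition_length_less_psize:
  assumes p: "\<kappa> \<in> partitions" and n: "\<kappa> n \<noteq> 0"
  shows "n < psize \<kappa>"
proof -
  have "finite {j. \<kappa> j \<noteq> 0}"
    using p by (simp add: partitions_def)
  moreover have "{..n} \<subseteq> {j. \<kappa> j \<noteq> 0}"
  proof
    fix j assume "j \<in> {..n}"
    then show "j \<in> {j. \<kappa> j \<noteq> 0}"
      using n partitions_antimono[OF p, of j n] by simp
  qed
  ultimately show ?thesis
    unfolding psize_def by (rule partition_vanishes_beyond_sum[OF p n])
qed

lemma finite_partitions_psize_le: "finite {\<kappa> \<in> partitions. psize \<kappa> \<le> N}"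
proof -
  have fin: "finite {f :: nat \<Rightarrow> nat. \<forall>x. (x \<in> {..N} \<longrightarrow> f x \<in> {..N}) \<and> (x \<notin> {..N} \<longrightarrow> f x = 0)}"
    by (rule finite_set_of_finite_funs) simp_all
  have "\<kappa> x \<le> N" if "\<kappa> \<in> partitions" "psize \<kappa> \<le> N" for \<kappa> x
  proof (cases "\<kappa> x = 0")
    case False
    have "finite {j. \<kappa> j \<noteq> 0}"
      using that by (simp add: partitions_def)
    then have "\<kappa> x \<le> psize \<kappa>"
      unfolding psize_def using False by (intro member_le_sum) auto
    then show ?thesis
      using that by simp
  qed simp
  moreover have "\<kappa> x = 0" if "\<kappa> \<in> partitions" "psize \<kappa> \<le> N" "x \<notin> {..N}" for \<kappa> x
    using partition_length_less_psize[OF that(1), of x] that(2,3) by (cases "\<kappa> x = 0") simp_all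
  ultimately have "{\<kappa> \<in> partitions. psize \<kappa> \<le> N} \<subseteq>
      {f. \<forall>x. (x \<in> {..N} \<longrightarrow> f x \<in> {..N}) \<and> (x \<notin> {..N} \<longrightarrow> f x = 0)}"
    by blast
  then show ?thesis
    using fin by (rule finite_subset)
qed

lemma P_box_partition: "\<kappa> \<in> P_box \<Longrightarrow> \<kappa> \<in> partitions"
  by (simp add: P_box_iff)

definition boxes :: "nat \<Rightarrow> (nat \<Rightarrow> nat) set" where
  "boxes m = {\<kappa> \<in> P_box. psize \<kappa> div 2 = m}"

text \<open>Allowing at most 2N rows corresponds to keeping the first N factors of the
  product.\<close>

definition boxes_le :: "nat \<Rightarrow> nat \<Rightarrow> (nat \<Rightarrow> nat) set" where
  "boxes_le N m = {\<kappa> \<in> boxes m. \<kappa> (2 * N) = 0}"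

lemma finite_boxes: "finite (boxes m)"
proof (rule finite_subset[OF _ finite_partitions_psize_le[of "2 * m + 1"]])
  show "boxes m \<subseteq> {\<kappa> \<in> partitions. psize \<kappa> \<le> 2 * m + 1}"
  proof
    fix \<kappa> assume "\<kappa> \<in> boxes m"
    then have "\<kappa> \<in> P_box" "psize \<kappa> div 2 = m"
      by (auto simp: boxes_def)
    moreover from this(2) have "psize \<kappa> \<le> 2 * m + 1"
      by linarith
    ultimately show "\<kappa> \<in> {\<kappa> \<in> partitions. psize \<kappa> \<le> 2 * m + 1}"
      by (simp add: P_box_partition)
  qed
qed

text \<open>Rows come in equal pairs, so a nonzero row 2N means at least 2N + 2 nonzero rows, and
  half of the size exceeds N.\<close>

lemma boxes_le_eq_boxes:
  assumes "m \<le> N"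
  shows "boxes_le N m = boxes m"
proof -
  have "\<kappa> (2 * N) = 0" if "\<kappa> \<in> boxes m" for \<kappa>
  proof (rule ccontr)
    have \<kappa>: "\<kappa> \<in> partitions" "\<kappa> (2 * N) = \<kappa> (2 * N + 1)" "psize \<kappa> div 2 = m"
      using that unfolding boxes_def P_box_iff by auto
    assume "\<kappa> (2 * N) \<noteq> 0"
    then have nz: "\<kappa> (2 * N + 1) \<noteq> 0"
      using \<kappa> by simp
    then have "2 * N + 1 < psize \<kappa>"
      by (rule partition_length_less_psize[OF \<kappa>(1)])
    then show False
      using \<kappa>(3) assms by simp
  qed
  then show ?thesis
    by (auto simp: boxes_le_def)
qed

lemma boxes_le_0: "boxes_le 0 m = (if m = 0 then {\<lambda>_. 0} else {})"
proof -
  have "\<kappa> = (\<lambda>_. 0)" if "\<kappa> \<in> P_box" "\<kappa> 0 = 0" for \<kappa>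
    using partitions_antimono[OF P_box_partition[OF that(1)], of 0] that(2) by (intro ext) simp
  moreover have "(\<lambda>_. 0) \<in> P_box" and size: "psize (\<lambda>_. 0) = 0"
    by (simp_all add: P_box_iff zero_partition psize_def)
  ultimately have "{\<kappa> \<in> P_box. \<kappa> 0 = 0} = {\<lambda>_. 0}"
    by blast
  moreover have "boxes_le 0 m = {\<kappa> \<in> {\<kappa> \<in> P_box. \<kappa> 0 = 0}. psize \<kappa> div 2 = m}"
    unfolding boxes_le_def boxes_def by auto
  ultimately have eq: "boxes_le 0 m = {\<kappa> \<in> {\<lambda>_. 0}. psize \<kappa> div 2 = m}"
    by (simp only:)
  show ?thesis
    using size unfolding eq by (cases "m = 0") auto
qed

text \<open>A member of \<open>P_box\<close> with exactly \<open>2(N + 1)\<close> rows arises from one with at most that many rows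
  by adding two columns of height \<open>2(N + 1)\<close>.\<close>

lemma boxes_le_Suc:
  "card (boxes_le (Suc N) m) =
    card (boxes_le N m) + (if m < 2 * (N + 1) then 0 else card (boxes_le (Suc N) (m - 2 * (N + 1))))"
proof -
  define M where "M = 2 * (N + 1)"
  define col :: "nat \<Rightarrow> nat" where "col j = (if j < M then 2 else 0)" for j
  have col_part: "col \<in> partitions"
    by (rule partitionsI[where R = M]) (auto simp: col_def)
  \<comment> \<open>The two columns of height M have total size 2M and so raise the half-size by M,
    the exponent in the factor.\<close>
  have col_size: "psize col = 2 * M"
    using psize_eq_sum[of "{..<M}" col] by (simp add: col_def)
  have col_pair: "col (2 * j) = col (2 * j + 1)" for j
  proof -
    have "2 * j < M \<longleftrightarrow> 2 * j + 1 < M"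
      unfolding M_def by presburger
    then show ?thesis
      by (simp only: col_def)
  qed
  define f where "f \<kappa> j = \<kappa> j + col j" for \<kappa> :: "nat \<Rightarrow> nat" and j
  have f_box: "f \<kappa> \<in> P_box" if "\<kappa> \<in> P_box" for \<kappa>
  proof -
    have \<kappa>: "\<kappa> \<in> partitions" "\<And>j. even (\<kappa> j)" "\<And>j. \<kappa> (2 * j) = \<kappa> (2 * j + 1)"
      using that by (auto simp: P_box_iff)
    obtain R where R: "\<And>j. R \<le> j \<Longrightarrow> \<kappa> j = 0"
      using partitions_eventually_0[OF \<kappa>(1)] by blast
    have "f \<kappa> \<in> partitions"
    proof (rule partitionsI)
      show "f \<kappa> (Suc j) \<le> f \<kappa> j" for j
        using partitions_antimono[OF \<kappa>(1), of j "Suc j"] partitions_antimono[OF col_part, of j "Suc j"]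
        by (simp add: f_def)
      show "f \<kappa> j = 0" if "R + M \<le> j" for j
        using R[of j] that by (simp add: f_def col_def)
    qed
    moreover have "even (f \<kappa> j)" for j
      using \<kappa>(2) by (simp add: f_def col_def)
    moreover have "f \<kappa> (2 * j) = f \<kappa> (2 * j + 1)" for j
      using \<kappa>(3) col_pair by (simp add: f_def)
    ultimately show ?thesis
      unfolding P_box_iff by blast
  qed
  have f_size: "psize (f \<kappa>) = psize \<kappa> + 2 * M" if "\<kappa> \<in> P_box" for \<kappa>
    using psize_add[OF P_box_partition[OF that] col_part] by (simp add: f_def[abs_def] col_size)
  have f_inj: "inj_on f A" for A
    by (rule inj_onI) (simp add: f_def fun_eq_iff)
  let ?A = "{\<kappa> \<in> boxes m. \<kappa> M = 0 \<and> \<kappa> (2 * N) \<noteq> 0}"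
  have A_image: "\<exists>\<kappa>'\<in>P_box. \<kappa>' M = 0 \<and> \<kappa> = f \<kappa>'" if "\<kappa> \<in> P_box" "\<kappa> M = 0" "\<kappa> (2 * N) \<noteq> 0" for \<kappa>
  proof -
    have \<kappa>: "\<kappa> \<in> partitions" "\<And>j. even (\<kappa> j)" "\<And>j. \<kappa> (2 * j) = \<kappa> (2 * j + 1)"
      using that by (auto simp: P_box_iff)
    \<comment> \<open>Row 2N + 1 is the last one before M. It equals row 2N, is nonzero and even,
      hence at least 2, so subtracting \<open>col\<close> is exact.\<close>
    have ge: "2 \<le> \<kappa> j" if "j < M" for j
    proof -
      have "\<kappa> (2 * N + 1) \<le> \<kappa> j"
        using that by (intro partitions_antimono[OF \<kappa>(1)]) (simp add: M_def)
      moreover have "2 \<le> \<kappa> (2 * N + 1)"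
        using \<open>\<kappa> (2 * N) \<noteq> 0\<close> \<kappa>(3)[of N] \<kappa>(2)[of "2 * N + 1"] by (elim evenE) simp
      ultimately show ?thesis
        by simp
    qed
    have zero: "\<kappa> j = 0" if "M \<le> j" for j
      using partitions_antimono[OF \<kappa>(1) that] \<open>\<kappa> M = 0\<close> by simp
    define \<kappa>' where "\<kappa>' j = \<kappa> j - col j" for j
    have f: "\<kappa> = f \<kappa>'"
      using ge by (auto simp: f_def \<kappa>'_def col_def fun_eq_iff)
    have "\<kappa>' \<in> partitions"
    proof (rule partitionsI)
      show "\<kappa>' (Suc j) \<le> \<kappa>' j" for j
      proof (cases "Suc j < M")
        case True
        then show ?thesis
          using partitions_antimono[OF \<kappa>(1), of j "Suc j"] by (simp add: \<kappa>'_def col_def diff_le_mono)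
      next
        case False
        then show ?thesis
          using zero[of "Suc j"] by (simp add: \<kappa>'_def)
      qed
      show "\<kappa>' j = 0" if "M \<le> j" for j
        using zero[OF that] by (simp add: \<kappa>'_def)
    qed
    moreover have "even (\<kappa>' j)" for j
      using \<kappa>(2) by (simp add: \<kappa>'_def col_def)
    moreover have "\<kappa>' (2 * j) = \<kappa>' (2 * j + 1)" for j
      using \<kappa>(3) col_pair by (simp add: \<kappa>'_def)
    ultimately have "\<kappa>' \<in> P_box"
      unfolding P_box_iff by blast
    moreover have "\<kappa>' M = 0"
      using \<open>\<kappa> M = 0\<close> by (simp add: \<kappa>'_def)
    ultimately show ?thesis
      using f by (intro bexI[of _ \<kappa>'] conjI)
  qed
  have card_A: "card ?A = (if m < M then 0 else card (boxes_le (Suc N) (m - M)))"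
  proof (cases "m < M")
    case True
    have "?A = {}"
    proof (rule ccontr)
      assume "?A \<noteq> {}"
      then obtain \<kappa> where \<kappa>: "\<kappa> \<in> P_box" "psize \<kappa> div 2 = m" "\<kappa> M = 0" "\<kappa> (2 * N) \<noteq> 0"
        by (auto simp: boxes_def)
      then obtain \<kappa>' where "\<kappa>' \<in> P_box" "\<kappa> = f \<kappa>'"
        using A_image by blast
      then show False
        using f_size[of \<kappa>'] \<kappa>(2) True by simp
    qed
    then show ?thesis
      using True by (simp only: card.empty if_True)
  next
    case False
    have "?A = f ` boxes_le (Suc N) (m - M)"
    proof (intro set_eqI iffI)
      fix \<kappa> assume "\<kappa> \<in> ?A"
      then have \<kappa>: "\<kappa> \<in> P_box" "psize \<kappa> div 2 = m" "\<kappa> M = 0" "\<kappa> (2 * N) \<noteq> 0"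
        by (auto simp: boxes_def)
      then obtain \<kappa>' where \<kappa>': "\<kappa>' \<in> P_box" "\<kappa>' M = 0" "\<kappa> = f \<kappa>'"
        using A_image by blast
      then have "\<kappa>' \<in> boxes_le (Suc N) (m - M)"
        using f_size[of \<kappa>'] \<kappa>(2) False by (simp add: boxes_le_def boxes_def M_def)
      then show "\<kappa> \<in> f ` boxes_le (Suc N) (m - M)"
        using \<kappa>'(3) by blast
    next
      fix \<kappa> assume "\<kappa> \<in> f ` boxes_le (Suc N) (m - M)"
      then obtain \<kappa>' where \<kappa>': "\<kappa>' \<in> P_box" "psize \<kappa>' div 2 = m - M" "\<kappa>' M = 0" "\<kappa> = f \<kappa>'"
        by (auto simp: boxes_le_def boxes_def M_def)
      have "\<kappa> M = 0" "\<kappa> (2 * N) \<noteq> 0"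
        using \<kappa>'(3) unfolding \<kappa>'(4) by (simp_all add: f_def col_def M_def)
      moreover have "\<kappa> \<in> boxes m"
        using f_box[OF \<kappa>'(1)] f_size[OF \<kappa>'(1)] \<kappa>'(2) False unfolding \<kappa>'(4) by (simp add: boxes_def)
      ultimately show "\<kappa> \<in> ?A"
        by blast
    qed
    then show ?thesis
      using False by (simp add: card_image[OF f_inj])
  qed
  have "\<kappa> M = 0" if "\<kappa> \<in> boxes_le N m" for \<kappa>
    using that partitions_antimono[of \<kappa> "2 * N" M] by (auto simp: boxes_le_def boxes_def P_box_iff M_def)
  then have "boxes_le (Suc N) m = boxes_le N m \<union> ?A"
    by (auto simp: boxes_le_def M_def)
  moreover have "card (boxes_le N m \<union> ?A) = card (boxes_le N m) + card ?A"
    using finite_boxes[of m] by (intro card_Un_disjoint) (auto simp: boxes_le_def)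
  ultimately show ?thesis
    unfolding card_A by (simp only: M_def)
qed

definition box_series :: "rat fps" where
  "box_series = Abs_fps (\<lambda>m. of_nat (card (boxes m)))"

text \<open>The recursion of \<open>boxes_le_Suc\<close> makes each partial product inverse to the
  series of \<open>boxes_le N\<close>. Up to degree n both factors agree with their limits once N is
  large.\<close>

lemma box_series_even_prod: "box_series * even_prod = 1"
proof (rule fps_ext)
  fix n
  define G where "G N = (Abs_fps (\<lambda>m. of_nat (card (boxes_le N m))) :: rat fps)" for N
  define P where "P N = (\<Prod>i<N. 1 - fps_X ^ (2 * (i + 1)) :: rat fps)" for N
  have G_Suc: "G (Suc N) * (1 - fps_X ^ (2 * (N + 1))) = G N" for N
  proof (rule fps_ext)
    fix m
    have "fps_nth (G (Suc N) * (1 - fps_X ^ (2 * (N + 1)))) m =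
      fps_nth (G (Suc N)) m - fps_nth (G (Suc N) * fps_X ^ (2 * (N + 1))) m"
      by (simp only: right_diff_distrib mult_1_right fps_sub_nth)
    also have "\<dots> = fps_nth (G N) m"
      unfolding fps_X_power_mult_right_nth G_def fps_nth_Abs_fps boxes_le_Suc[of N m] by simp
    finally show "fps_nth (G (Suc N) * (1 - fps_X ^ (2 * (N + 1)))) m = fps_nth (G N) m" .
  qed
  have GP: "G N * P N = 1" for N
  proof (induction N)
    case 0
    show ?case
      by (rule fps_ext) (simp add: G_def P_def boxes_le_0)
  next
    case (Suc N)
    have "G (Suc N) * P (Suc N) = (G (Suc N) * (1 - fps_X ^ (2 * (N + 1)))) * P N"
      unfolding P_def prod.lessThan_Suc by (simp only: ac_simps)
    then show ?case
      unfolding G_Suc using Suc by simp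
  qed
  have "(\<lambda>N. \<Prod>i\<le>N. 1 - fps_X ^ (2 * (i + 1)) :: rat fps) \<longlonglongrightarrow> even_prod"
    by (rule has_prod_imp_tendsto[OF even_prod_has_prod])
  then have "eventually (\<lambda>N. fps_nth (P (Suc N)) k = fps_nth even_prod k) sequentially" for k
    unfolding tendsto_fps_iff P_def lessThan_Suc_atMost by blast
  then have "eventually (\<lambda>N. \<forall>k\<in>{..n}. fps_nth (P (Suc N)) k = fps_nth even_prod k) sequentially"
    by (intro eventually_ball_finite) auto
  then obtain N0 where N0: "\<And>N. N0 \<le> N \<Longrightarrow> \<forall>k\<in>{..n}. fps_nth (P (Suc N)) k = fps_nth even_prod k"
    unfolding eventually_sequentially by blast
  define N where "N = N0 + n"
  have "fps_nth (box_series * even_prod) n = fps_nth (G (Suc N) * P (Suc N)) n"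
    unfolding fps_mult_nth
  proof (rule sum.cong[OF refl])
    fix i assume "i \<in> {0..n}"
    then show "fps_nth box_series i * fps_nth even_prod (n - i) = fps_nth (G (Suc N)) i * fps_nth (P (Suc N)) (n - i)"
      using N0[of N] boxes_le_eq_boxes[of i "Suc N"] by (simp add: box_series_def G_def N_def)
  qed
  then show "fps_nth (box_series * even_prod) n = fps_nth 1 n"
    by (simp only: GP)
qed

subsection \<open>The bijection behind the theorem\<close>

definition phi_mu :: "(nat \<Rightarrow> nat) \<Rightarrow> (nat \<Rightarrow> nat \<Rightarrow> nat) \<Rightarrow> nat \<Rightarrow> nat" where
  "phi_mu lam b j = phi_vec lam b j + mu_res lam b j"

context
  fixes lam :: "nat \<Rightarrow> nat"
  assumes lam: "lam \<in> partitions"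
begin

lemma D_SSYT: "b \<in> D lam \<Longrightarrow> b \<in> SSYT lam"
  by (simp add: D_def)

lemma phi_mu_P_two: "b \<in> D lam \<Longrightarrow> phi_mu lam b \<in> P_two"
  using mu_res_distinguished[OF lam] unfolding distinguished_iff phi_mu_def[abs_def] by blast

text \<open>A letter x in b makes row x - 1 of \<open>phi_mu\<close> nonzero, because \<phi>
  dominates the content. So the size bounds all letters.\<close>

lemma finite_D_fibre: "finite {b \<in> D lam. psize (phi_mu lam b) div 2 = n}"
proof (rule finite_subset[OF _ finite_SSYT_le[OF lam, of "2 * n + 1"]])
  show "{b \<in> D lam. psize (phi_mu lam b) div 2 = n} \<subseteq> SSYT_le (2 * n + 1) lam"
  proof
    fix b assume "b \<in> {b \<in> D lam. psize (phi_mu lam b) div 2 = n}"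
    then have b: "b \<in> D lam" and n: "psize (phi_mu lam b) \<le> 2 * n + 1"
      by auto
    note T = D_SSYT[OF b]
    show "b \<in> SSYT_le (2 * n + 1) lam"
    proof (rule SSYT_leI[OF T])
      fix r c assume c: "c < lam r"
      then have x: "1 \<le> b r c"
        by (rule SSYT_pos[OF T])
      have "letter_count lam b (b r c) \<noteq> 0"
        using letter_count_pos_iff[OF lam] c by blast
      then have "phi_mu lam b (b r c - 1) \<noteq> 0"
        using x by (simp add: phi_mu_def phi_vec_eq[OF T lam])
      then have "b r c - 1 < psize (phi_mu lam b)"
        by (rule partition_length_less_psize[OF P_two_partition[OF phi_mu_P_two[OF b]]])
      then show "b r c \<le> 2 * n + 1"
        using n by simp
    qed
  qed
qed

text \<open>\<open>W n\<close> and \<open>Q n\<close> are what coefficient n counts in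
  \<open>D_series * box_series\<close> and in \<open>LR_series\<close>, respectively.\<close>

definition W :: "nat \<Rightarrow> ((nat \<Rightarrow> nat \<Rightarrow> nat) \<times> (nat \<Rightarrow> nat)) set" where
  "W n = {(b, \<kappa>). b \<in> D lam \<and> \<kappa> \<in> P_box \<and> psize (phi_mu lam b) div 2 + psize \<kappa> div 2 = n}"

definition Q :: "nat \<Rightarrow> (((nat \<Rightarrow> nat) \<times> (nat \<Rightarrow> nat)) \<times> (nat \<Rightarrow> nat \<Rightarrow> nat)) set" where
  "Q n = {((\<nu>, \<delta>), T). \<nu> \<in> P_two \<and> \<delta> \<in> P_oneone \<and> psize \<nu> div 2 = n \<and>
     T \<in> LR_tableaux lam \<delta> \<and> add_content \<delta> lam T = \<nu>}"

lemma W_eq: "W n = (\<Union>i\<in>{..n}. {b \<in> D lam. psize (phi_mu lam b) div 2 = i} \<times> boxes (n - i))"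
  unfolding W_def boxes_def by auto

lemma finite_W: "finite (W n)"
  unfolding W_eq using finite_D_fibre finite_boxes by simp

lemma card_W: "card (W n) = (\<Sum>i\<le>n. card {b \<in> D lam. psize (phi_mu lam b) div 2 = i} * card (boxes (n - i)))"
proof -
  have "card (W n) = (\<Sum>i\<in>{..n}. card ({b \<in> D lam. psize (phi_mu lam b) div 2 = i} \<times> boxes (n - i)))"
    unfolding W_eq by (rule card_UN_disjoint) (use finite_D_fibre finite_boxes in auto)
  then show ?thesis
    by (simp add: card_cartesian_product)
qed

text \<open>The tableau is kept, and \<mu> = \<open>mu_res\<close> + \<kappa> is added to \<phi> and
  \<epsilon>. Backwards, \<mu> is \<delta> - \<epsilon>, and \<kappa> is its excess over
  \<open>mu_res\<close>.\<close>

lemma bij_betw_W_Q: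
  "bij_betw (\<lambda>(b, \<kappa>). ((\<lambda>j. phi_mu lam b j + \<kappa> j, \<lambda>j. eps_vec lam b j + mu_res lam b j + \<kappa> j), b)) (W n) (Q n)"
    (is "bij_betw ?h _ _")
proof (rule bij_betw_imageI)
  show "inj_on ?h (W n)"
    by (rule inj_onI) (auto simp: fun_eq_iff)
  show "?h ` W n = Q n"
  proof (intro equalityI subsetI)
    fix x assume "x \<in> ?h ` W n"
    then obtain b \<kappa> where b: "b \<in> D lam" and \<kappa>: "\<kappa> \<in> P_box"
      and n: "psize (phi_mu lam b) div 2 + psize \<kappa> div 2 = n" and x: "x = ?h (b, \<kappa>)"
      unfolding W_def by blast
    note T = D_SSYT[OF b]
    let ?\<delta> = "\<lambda>j. eps_vec lam b j + mu_res lam b j + \<kappa> j"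
    let ?\<nu> = "\<lambda>j. phi_mu lam b j + \<kappa> j"
    have "(\<lambda>j. eps_vec lam b j + mu_res lam b j) \<in> P_oneone"
      using mu_res_distinguished[OF lam b] unfolding distinguished_iff by (rule conjunct2)
    from P_box_add(2)[OF this \<kappa>] have \<delta>: "?\<delta> \<in> P_oneone" .
    have \<nu>: "?\<nu> \<in> P_two"
      by (rule P_box_add(1)[OF phi_mu_P_two[OF b] \<kappa>])
    have "\<kappa> \<in> P_two"
      using \<kappa> by (simp add: P_box_def)
    then have "even (psize \<kappa>)"
      by (rule psize_P_two_even)
    then have size: "psize ?\<nu> div 2 = n"
      unfolding psize_add[OF P_two_partition[OF phi_mu_P_two[OF b]] P_box_partition[OF \<kappa>]] n[symmetric]
      by (elim evenE) simp
    \<comment> \<open>The summands besides \<epsilon> are partitions, so they only enlarge the row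
      differences of \<delta>.\<close>
    have "eps i lam b + ?\<delta> i \<le> ?\<delta> (i - 1)" if "1 \<le> i" for i
    proof -
      have "eps_vec lam b (i - 1) = eps i lam b + eps_vec lam b i"
        using comb_omega_Suc[OF finite_eps[OF T lam], of "i - 1"] that by (simp add: eps_vec_def)
      moreover have "mu_res lam b i \<le> mu_res lam b (i - 1)"
        by (rule partitions_antimono[OF mu_res_partition[OF T lam]]) simp
      moreover have "\<kappa> i \<le> \<kappa> (i - 1)"
        by (rule partitions_antimono[OF P_box_partition[OF \<kappa>]]) simp
      ultimately show ?thesis
        by linarith
    qed
    then have "b \<in> LR_tableaux lam ?\<delta>"
      unfolding LR_tableaux_def using T good_iff_eps[OF T lam P_oneone_partition[OF \<delta>]] by blast
    moreover have "add_content ?\<delta> lam b = ?\<nu>"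
      by (rule ext) (simp add: add_content_def phi_mu_def phi_vec_eq[OF T lam])
    ultimately show "x \<in> Q n"
      unfolding x Q_def using \<nu> \<delta> size by simp
  next
    fix x assume "x \<in> Q n"
    then obtain \<nu> \<delta> T where x: "x = ((\<nu>, \<delta>), T)" and \<nu>: "\<nu> \<in> P_two" and \<delta>: "\<delta> \<in> P_oneone"
      and n: "psize \<nu> div 2 = n" and T: "T \<in> SSYT lam" and gd: "good \<delta> lam T" and add: "add_content \<delta> lam T = \<nu>"
      unfolding Q_def LR_tableaux_def by blast
    note \<delta>p = P_oneone_partition[OF \<delta>]
    note eps = finite_eps[OF T lam]
    obtain d where d: "finite {i. d i \<noteq> 0}" "\<delta> = comb d omega"
      using partition_eq_comb[OF \<delta>p] by blast
    have le: "eps i lam T \<le> d i" if "1 \<le> i" for i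
    proof -
      have "\<delta> (i - 1) = d i + \<delta> i"
        using comb_omega_Suc[OF d(1), of "i - 1"] that by (simp add: d(2))
      moreover have "eps i lam T + \<delta> i \<le> \<delta> (i - 1)"
        using gd that unfolding good_iff_eps[OF T lam \<delta>p] by blast
      ultimately show ?thesis
        by linarith
    qed
    \<comment> \<open>The coefficients of \<delta> - \<epsilon>; the subtraction is exact for
      positive i by the lattice condition.\<close>
    define m where "m i = (if i = 0 then 0 else d i - eps i lam T)" for i
    have "{i. m i \<noteq> 0} \<subseteq> {i. d i \<noteq> 0}"
      by (auto simp: m_def)
    then have m: "finite {i. m i \<noteq> 0}"
      using d(1) by (rule finite_subset)
    define \<mu> where "\<mu> = comb m omega"
    have \<mu>: "\<mu> \<in> partitions"
      unfolding \<mu>_def by (rule comb_omega_partition[OF m])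
    have "{i. eps i lam T + m i \<noteq> 0} = {i. eps i lam T \<noteq> 0} \<union> {i. m i \<noteq> 0}"
      by auto
    then have fin: "finite {i. eps i lam T + m i \<noteq> 0}"
      using eps m by simp
    have "d i = eps i lam T + m i" if "1 \<le> i" for i
      using le[OF that] that by (simp add: m_def)
    then have "comb d omega = comb (\<lambda>i. eps i lam T + m i) omega"
      unfolding comb_omega_eq_iff[OF d(1) fin] by blast
    then have \<delta>_eq: "\<delta> = (\<lambda>j. eps_vec lam T j + \<mu> j)"
      unfolding d(2) eps_vec_def \<mu>_def comb_omega_add[OF eps m, symmetric] .
    have \<nu>_eq: "\<nu> = (\<lambda>j. phi_vec lam T j + \<mu> j)"
      unfolding add[symmetric] by (rule ext) (simp add: add_content_def \<delta>_eq phi_vec_eq[OF T lam])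
    have dist: "distinguished lam \<mu> T"
      unfolding distinguished_iff using \<nu> \<delta> unfolding \<nu>_eq \<delta>_eq by blast
    then have TD: "T \<in> D lam"
      using T \<mu> by (auto simp: D_def)
    obtain \<kappa> where \<kappa>: "\<kappa> \<in> P_box" "\<mu> = (\<lambda>j. mu_res lam T j + \<kappa> j)"
      using distinguished_imp_mu_res_box(2)[OF T lam \<mu> dist] by blast
    have \<nu>_eq': "\<nu> = (\<lambda>j. phi_mu lam T j + \<kappa> j)"
      unfolding \<nu>_eq \<kappa>(2) phi_mu_def by (simp add: add.assoc)
    have "\<kappa> \<in> P_two"
      using \<kappa> by (simp add: P_box_def)
    then have "even (psize \<kappa>)"
      by (rule psize_P_two_even)
    then have "psize (phi_mu lam T) div 2 + psize \<kappa> div 2 = n"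
      unfolding n[symmetric] \<nu>_eq' psize_add[OF P_two_partition[OF phi_mu_P_two[OF TD]] P_box_partition[OF \<kappa>(1)]]
      by (elim evenE) simp
    then have "(T, \<kappa>) \<in> W n"
      unfolding W_def using TD \<kappa>(1) by simp
    moreover have "x = ?h (T, \<kappa>)"
      unfolding x \<nu>_eq' \<delta>_eq \<kappa>(2) by (simp add: add.assoc)
    ultimately show "x \<in> ?h ` W n"
      by blast
  qed
qed

section \<open>Comparison of the power series\<close>

definition D_series :: "rat fps" where
  "D_series = Abs_fps (\<lambda>n. of_nat (card {b \<in> D lam. psize (phi_mu lam b) div 2 = n}))"

lemma D_series_has_sum: "((\<lambda>b. fps_X ^ (psize (phi_mu lam b) div 2)) has_sum D_series) (D lam)"
proof (rule has_sum_fpsI)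
  fix n
  have eq: "{b \<in> D lam. fps_nth (fps_X ^ (psize (phi_mu lam b) div 2) :: rat fps) n \<noteq> 0} =
      {b \<in> D lam. psize (phi_mu lam b) div 2 = n}"
    by (auto simp: fps_X_power_nth)
  show "finite {b \<in> D lam. fps_nth (fps_X ^ (psize (phi_mu lam b) div 2) :: rat fps) n \<noteq> 0}"
    unfolding eq by (rule finite_D_fibre)
  show "fps_nth D_series n = (\<Sum>b | b \<in> D lam \<and> fps_nth (fps_X ^ (psize (phi_mu lam b) div 2) :: rat fps) n \<noteq> 0.
      fps_nth (fps_X ^ (psize (phi_mu lam b) div 2)) n)"
  proof -
    have "(\<Sum>b | b \<in> D lam \<and> psize (phi_mu lam b) div 2 = n. fps_nth (fps_X ^ (psize (phi_mu lam b) div 2)) n) =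
        (\<Sum>b | b \<in> D lam \<and> psize (phi_mu lam b) div 2 = n. 1 :: rat)"
      by (rule sum.cong) (auto simp: fps_X_power_nth)
    then show ?thesis
      unfolding D_series_def fps_nth_Abs_fps eq by (simp only: sum_constant mult_1_right)
  qed
qed

lemma LR_series_eq: "LR_series lam = D_series * box_series"
proof -
  have "((\<lambda>(\<nu>, \<delta>). of_int (LR lam \<delta> \<nu>) * fps_X ^ (psize \<nu> div 2)) has_sum (D_series * box_series)) (P_two \<times> P_oneone)"
    (is "(?F has_sum _) ?P")
  proof (rule has_sum_fpsI)
    fix n
    let ?t = "\<lambda>x. {T \<in> LR_tableaux lam (snd x). add_content (snd x) lam T = fst x}"
    have finQ: "finite (Q n)"
      using bij_betw_finite[OF bij_betw_W_Q] finite_W by blast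
    have coeff: "fps_nth (?F x) n = (if psize (fst x) div 2 = n then of_nat (card (?t x)) else 0)" if "x \<in> ?P" for x
    proof -
      have LR: "LR lam (snd x) (fst x) = int (card (?t x))"
        using that by (intro LR_rule[OF lam P_oneone_partition]) (simp only: mem_Times_iff)
      have "?F x = of_int (LR lam (snd x) (fst x)) * fps_X ^ (psize (fst x) div 2)"
        by (rule case_prod_beta)
      also have "\<dots> = of_nat (card (?t x)) * fps_X ^ (psize (fst x) div 2)"
        unfolding LR by (simp only: of_int_of_nat_eq)
      finally have F: "?F x = of_nat (card (?t x)) * fps_X ^ (psize (fst x) div 2)" .
      show ?thesis
        unfolding F fps_of_nat[symmetric] fps_mult_left_const_nth fps_X_power_nth by simp
    qed
    have fin_t: "finite (?t x)" if "x \<in> ?P" for x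
    proof -
      have "finite (LR_tableaux lam (snd x))"
        using that by (intro finite_LR_tableaux[OF lam P_oneone_partition]) (simp only: mem_Times_iff)
      then show ?thesis
        by (rule rev_finite_subset) blast
    qed
    let ?S = "{x \<in> ?P. fps_nth (?F x) n \<noteq> 0}"
    have S_eq: "?S = {x \<in> ?P. psize (fst x) div 2 = n \<and> ?t x \<noteq> {}}"
    proof (rule Collect_cong, rule conj_cong[OF refl])
      fix x assume "x \<in> ?P"
      then show "fps_nth (?F x) n \<noteq> 0 \<longleftrightarrow> psize (fst x) div 2 = n \<and> ?t x \<noteq> {}"
        using fin_t[of x] unfolding coeff[OF \<open>x \<in> ?P\<close>] by (simp add: card_eq_0_iff)
    qed
    \<comment> \<open>\<open>Q n\<close> fibres over the pairs that contribute to degree n.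
      Finiteness of \<open>Q n\<close>, inherited from \<open>W n\<close>, therefore yields the
      finite support that summability requires.\<close>
    have Q_eq: "Q n = Sigma ?S ?t"
      unfolding S_eq Q_def by auto
    have "x \<in> fst ` Q n" if x: "x \<in> ?S" for x
    proof -
      obtain T where "T \<in> ?t x"
        using x unfolding S_eq by blast
      then have "(x, T) \<in> Q n"
        unfolding Q_eq using x by (intro SigmaI)
      then show ?thesis
        by (rule rev_image_eqI) simp
    qed
    then have "?S \<subseteq> fst ` Q n"
      by (rule subsetI)
    then show finS: "finite ?S"
      by (rule finite_surj[OF finQ])
    have "(\<Sum>x\<in>?S. fps_nth (?F x) n) = (\<Sum>x\<in>?S. of_nat (card (?t x)))"
    proof (rule sum.cong[OF refl])
      fix x assume "x \<in> ?S"
      then have "x \<in> ?P" "psize (fst x) div 2 = n"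
        unfolding S_eq by blast+
      then show "fps_nth (?F x) n = of_nat (card (?t x))"
        unfolding coeff[OF \<open>x \<in> ?P\<close>] by (simp only: if_True refl)
    qed
    also have "\<dots> = of_nat (card (Q n))"
    proof -
      have "card (Q n) = (\<Sum>x\<in>?S. card (?t x))"
        unfolding Q_eq by (rule card_SigmaI[OF finS]) (use fin_t in blast)
      then show ?thesis
        by (simp only: of_nat_sum)
    qed
    also have "card (Q n) = card (W n)"
      using bij_betw_same_card[OF bij_betw_W_Q] ..
    also have "of_nat (card (W n)) = fps_nth (D_series * box_series) n"
      unfolding card_W fps_mult_nth D_series_def box_series_def by (simp add: atLeast0AtMost)
    finally show "fps_nth (D_series * box_series) n = (\<Sum>x\<in>?S. fps_nth (?F x) n)"
      by simp
  qed
  then show ?thesis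
    unfolding LR_series_def by (rule infsumI)
qed

lemma K_C_inf_eq: "K_C_inf lam = D_series"
proof -
  have unit: "is_unit even_prod"
    using even_prod_nth_0 by (simp add: fps_is_unit_iff)
  have "D_series = LR_series lam * even_prod"
    unfolding LR_series_eq mult.assoc box_series_even_prod by simp
  then have "D_series / even_prod = LR_series lam"
    by (simp only: unit_eq_div1[OF unit])
  then show ?thesis
    by (rule K_C_inf_iff[THEN iffD2, symmetric])
qed

end

theorem theorem4p7:
  fixes lam :: "nat \<Rightarrow> nat"
  assumes "lam \<in> partitions"
  shows "((\<lambda>b. fps_X ^ (psize (\<lambda>j. phi_vec lam b j + mu_min lam b j) div 2)) has_sum K_C_inf lam) (D lam)"
proof -
  have "((\<lambda>b. fps_X ^ (psize (phi_mu lam b) div 2)) has_sum K_C_inf lam) (D lam)"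
    unfolding K_C_inf_eq[OF assms] by (rule D_series_has_sum[OF assms])
  moreover have "phi_mu lam b = (\<lambda>j. phi_vec lam b j + mu_min lam b j)" if "b \<in> D lam" for b
    unfolding mu_min_eq[OF assms that] by (rule ext) (rule phi_mu_def)
  ultimately show ?thesis
    by (simp cong: has_sum_cong)
qed

end
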